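(* Let $(M,\pi)$ be a Poisson manifold and let $x\in M$ be an isotropy point, i.e. $\pi_x=0$. If $(M,\pi)$ is locally desingularizable at $x$, then the Lie algebra $\mathfrak{g}_x=(T_x^*M,[\cdot,\cdot]_\pi)$ contains a nonzero abelian ideal.
   Context: Manifolds are smooth, connected and without boundary. A Lie algebroid over $U$ is a smooth vector bundle $\mathcal{A}\to U$ (of constant rank) with a Lie bracket on $\Gamma(\mathcal{A})$ and a bundle map $\rho:\mathcal{A}\to TU$ (the anchor) satisfying the Leibniz rule. It is almost-injective if $\rho_p$ is injective for all $p$ in some open dense subset of $U$. A symplectic Lie algebroid $(\mathcal{A},\rho,\pi_{\mathcal{A}})$ is a Lie algebroid with a nondegenerate section $\pi_{\mathcal{A}}\in\Gamma(\bigwedge^2\mathcal{A})$ (i.e. $\pi_{\mathcal{A}}^\sharp:\mathcal{A}^*\to\mathcal{A}$ is an isomorphism) with $[\pi_{\mathcal{A}},\pi_{\mathcal{A}}]=0$ for the Schouten-Nijenhuis bracket. Rank $0$ is allowed. $(M,\pi)$ is locally desingularizable at $x$ if there exist an open set $U\ni x$ and a symplectic Lie algebroid $(\mathcal{A},\rho,\pi_{\mathcal{A}})$ over $U$ with almost-injective anchor such that $\wedge^2\rho(\pi_{\mathcal{A}})=\pi|_U$. At an isotropy point $x$, the space $T_x^*M$ is a Lie algebra, denoted $\mathfrak{g}_x$, with bracket $[d_xf,d_xg]_\pi=d_x\{f,g\}$, where $\{f,g\}=\pi(df,dg)$.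
   Formalization: The manifold M is assumed to have positive dimension; for a one-point M with π = 0 and the rank-0 algebroid the claim as printed fails, since T_x^*M = 0 contains no nonzero ideal. *)

theory Defs
  imports "HOL-Analysis.Analysis"
begin

section \<open>Smooth manifolds\<close>

primrec Ck_on :: "nat \<Rightarrow> 'a::real_normed_vector set \<Rightarrow> ('a \<Rightarrow> 'b::real_normed_vector) \<Rightarrow> bool" where
  "Ck_on 0 S f \<longleftrightarrow> continuous_on S f"
| "Ck_on (Suc k) S f \<longleftrightarrow>
     (\<forall>x\<in>S. f differentiable (at x)) \<and> (\<forall>v. Ck_on k S (\<lambda>x. frechet_derivative f (at x) v))"

text \<open>Only used for open \<open>S\<close> in finite-dimensional spaces, where this is the usual notion.\<close>

definition smooth_on :: "'a::real_normed_vector set \<Rightarrow> ('a \<Rightarrow> 'b::real_normed_vector) \<Rightarrow> bool" where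
  "smooth_on S f \<longleftrightarrow> (\<forall>k. Ck_on k S f)"

type_synonym ('m, 'e) chart = "'m set \<times> ('m \<Rightarrow> 'e)"

text \<open>
  Manifolds are modelled on \<^typ>\<open>'e\<close> of class \<^class>\<open>euclidean_space\<close>, so their dimension is an arbitrary
  positive number; the one-point manifold is excluded.
\<close>

record ('m, 'e) mfd =
  mtop :: "'m topology"
  atlas :: "('m, 'e) chart set"

definition is_chart :: "'m topology \<Rightarrow> ('m, 'e::euclidean_space) chart \<Rightarrow> bool" where
  "is_chart X = (\<lambda>(D, \<phi>). openin X D \<and> open (\<phi> ` D) \<and>
     homeomorphic_map (subtopology X D) (top_of_set (\<phi> ` D)) \<phi>)"

definition smooth_manifold :: "('m, 'e::euclidean_space) mfd \<Rightarrow> bool" where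
  "smooth_manifold M \<longleftrightarrow>
     Hausdorff_space (mtop M) \<and> second_countable (mtop M) \<and> connected_space (mtop M) \<and>
     (\<forall>c\<in>atlas M. is_chart (mtop M) c) \<and>
     (\<Union>(D, \<phi>)\<in>atlas M. D) = topspace (mtop M) \<and>
     (\<forall>(D, \<phi>)\<in>atlas M. \<forall>(D', \<psi>)\<in>atlas M.
        smooth_on (\<phi> ` (D \<inter> D')) (\<psi> \<circ> inv_into D \<phi>))"

definition smooth_fun :: "('m, 'e::euclidean_space) mfd \<Rightarrow> 'm set \<Rightarrow> ('m \<Rightarrow> 'b::real_normed_vector) \<Rightarrow> bool" where
  "smooth_fun M W f \<longleftrightarrow>
     openin (mtop M) W \<and> (\<forall>(D, \<phi>)\<in>atlas M. smooth_on (\<phi> ` (D \<inter> W)) (f \<circ> inv_into D \<phi>))"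

text \<open>
  Every point \<open>p\<close> has a distinguished chart \<open>chart_at M p\<close> of the atlas. The tangent space at \<open>p\<close> is
  modelled by \<^typ>\<open>'e\<close> and the cotangent space by \<^typ>\<open>'e \<Rightarrow>\<^sub>L real\<close>, both read in that chart.
  The differential of \<open>f\<close> at \<open>p\<close> is hence the derivative of the expression of \<open>f\<close> in that chart;
  nothing is assumed about how \<open>chart_at M p\<close> varies with \<open>p\<close>, and smoothness of tensor fields is
  always tested in fixed charts of the atlas.
\<close>

definition chart_at :: "('m, 'e::euclidean_space) mfd \<Rightarrow> 'm \<Rightarrow> ('m, 'e) chart" where
  "chart_at M p = (SOME c. c \<in> atlas M \<and> p \<in> fst c)"

definition differential ::
  "('m, 'e::euclidean_space) mfd \<Rightarrow> ('m \<Rightarrow> 'b::real_normed_vector) \<Rightarrow> 'm \<Rightarrow> 'e \<Rightarrow>\<^sub>L 'b" where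
  "differential M f p =
     (case chart_at M p of (D, \<phi>) \<Rightarrow> Blinfun (frechet_derivative (f \<circ> inv_into D \<phi>) (at (\<phi> p))))"

definition smooth_vector_field ::
  "('m, 'e::euclidean_space) mfd \<Rightarrow> 'm set \<Rightarrow> ('m \<Rightarrow> 'e) \<Rightarrow> bool" where
  "smooth_vector_field M W X \<longleftrightarrow>
     (\<forall>(D, \<phi>)\<in>atlas M. smooth_fun M (D \<inter> W) (\<lambda>p. blinfun_apply (differential M \<phi> p) (X p)))"

abbreviation smooth_functions :: "('m, 'e::euclidean_space) mfd \<Rightarrow> ('m \<Rightarrow> real) set" where
  "smooth_functions M \<equiv> {f. smooth_fun M (topspace (mtop M)) f}"


section \<open>Poisson manifolds\<close>

text \<open>Bivectors are identified with alternating bilinear forms on the cotangent space.\<close>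

type_synonym ('m, 'e) bivector_field = "'m \<Rightarrow> ('e \<Rightarrow>\<^sub>L real) \<Rightarrow> ('e \<Rightarrow>\<^sub>L real) \<Rightarrow> real"

definition smooth_bivector_field ::
  "('m, 'e::euclidean_space) mfd \<Rightarrow> ('m, 'e) bivector_field \<Rightarrow> bool" where
  "smooth_bivector_field M \<pi> \<longleftrightarrow>
     (\<forall>p\<in>topspace (mtop M). bilinear (\<pi> p) \<and> (\<forall>\<xi>. \<pi> p \<xi> \<xi> = 0)) \<and>
     (\<forall>(D, \<phi>)\<in>atlas M. \<forall>b\<in>Basis. \<forall>c\<in>Basis.
        smooth_fun M D (\<lambda>p. \<pi> p (differential M (\<lambda>q. \<phi> q \<bullet> b) p) (differential M (\<lambda>q. \<phi> q \<bullet> c) p)))"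

definition poisson_bracket ::
  "('m, 'e::euclidean_space) mfd \<Rightarrow> ('m, 'e) bivector_field \<Rightarrow> ('m \<Rightarrow> real) \<Rightarrow> ('m \<Rightarrow> real) \<Rightarrow> 'm \<Rightarrow> real" where
  "poisson_bracket M \<pi> f g = (\<lambda>p. \<pi> p (differential M f p) (differential M g p))"

definition poisson_manifold ::
  "('m, 'e::euclidean_space) mfd \<Rightarrow> ('m, 'e) bivector_field \<Rightarrow> bool" where
  "poisson_manifold M \<pi> \<longleftrightarrow>
     smooth_manifold M \<and> smooth_bivector_field M \<pi> \<and>
     (\<forall>f\<in>smooth_functions M. \<forall>g\<in>smooth_functions M. \<forall>h\<in>smooth_functions M. \<forall>p\<in>topspace (mtop M).
        poisson_bracket M \<pi> f (poisson_bracket M \<pi> g h) p +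
        poisson_bracket M \<pi> g (poisson_bracket M \<pi> h f) p +
        poisson_bracket M \<pi> h (poisson_bracket M \<pi> f g) p = 0)"

definition isotropy_point ::
  "('m, 'e::euclidean_space) mfd \<Rightarrow> ('m, 'e) bivector_field \<Rightarrow> 'm \<Rightarrow> bool" where
  "isotropy_point M \<pi> x \<longleftrightarrow> x \<in> topspace (mtop M) \<and> (\<forall>\<xi> \<eta>. \<pi> x \<xi> \<eta> = 0)"

text \<open>The bracket of the isotropy Lie algebra, on the cotangent space at an isotropy point \<open>x\<close>.\<close>

definition isotropy_bracket ::
  "('m, 'e::euclidean_space) mfd \<Rightarrow> ('m, 'e) bivector_field \<Rightarrow> 'm \<Rightarrow>
    ('e \<Rightarrow>\<^sub>L real) \<Rightarrow> ('e \<Rightarrow>\<^sub>L real) \<Rightarrow> ('e \<Rightarrow>\<^sub>L real)" where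
  "isotropy_bracket M \<pi> x \<xi> \<eta> =
     (THE \<zeta>. \<exists>f\<in>smooth_functions M. \<exists>g\<in>smooth_functions M.
        differential M f x = \<xi> \<and> differential M g x = \<eta> \<and>
        \<zeta> = differential M (poisson_bracket M \<pi> f g) x)"

definition lie_ideal :: "('a::real_vector \<Rightarrow> 'a \<Rightarrow> 'a) \<Rightarrow> 'a set \<Rightarrow> bool" where
  "lie_ideal br I \<longleftrightarrow> subspace I \<and> (\<forall>\<xi>. \<forall>\<eta>\<in>I. br \<xi> \<eta> \<in> I)"

definition lie_abelian_on :: "('a::real_vector \<Rightarrow> 'a \<Rightarrow> 'a) \<Rightarrow> 'a set \<Rightarrow> bool" where
  "lie_abelian_on br I \<longleftrightarrow> (\<forall>\<xi>\<in>I. \<forall>\<eta>\<in>I. br \<xi> \<eta> = 0)"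


section \<open>Vector bundles\<close>

text \<open>
  A vector bundle over an open set \<open>vb_base E\<close> is given by its fibres and a vector bundle atlas. The
  fibres are linear subspaces of one real vector space \<^typ>\<open>'v\<close>, which only serves as a universe: no
  relation between the topologies of \<^typ>\<open>'v\<close> and of the bundle is assumed. A member \<open>(V, e)\<close> of
  \<open>vb_frames E\<close> is the local trivialization \<open>(p, c) \<mapsto> (\<Sum>i<vb_rank E. c i *\<^sub>R e i p)\<close> over \<open>V\<close>.
\<close>

record ('m, 'v) vbundle =
  vb_base :: "'m set"
  vb_rank :: nat
  vb_fibre :: "'m \<Rightarrow> 'v set"
  vb_frames :: "('m set \<times> (nat \<Rightarrow> 'm \<Rightarrow> 'v)) set"

definition smooth_in_frame ::
  "('m, 'e::euclidean_space) mfd \<Rightarrow> nat \<Rightarrow> 'm set \<Rightarrow> (nat \<Rightarrow> 'm \<Rightarrow> 'v::real_vector) \<Rightarrow> ('m \<Rightarrow> 'v) \<Rightarrow> bool" where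
  "smooth_in_frame M k V e s \<longleftrightarrow>
     (\<exists>c. (\<forall>i<k. smooth_fun M V (c i)) \<and> (\<forall>p\<in>V. s p = (\<Sum>i<k. c i p *\<^sub>R e i p)))"

definition smooth_vbundle ::
  "('m, 'e::euclidean_space) mfd \<Rightarrow> ('m, 'v::real_vector, 'z) vbundle_scheme \<Rightarrow> bool" where
  "smooth_vbundle M E \<longleftrightarrow>
     openin (mtop M) (vb_base E) \<and>
     (\<Union>(V, e)\<in>vb_frames E. V) = vb_base E \<and>
     (\<forall>p\<in>vb_base E. subspace (vb_fibre E p)) \<and>
     (\<forall>(V, e)\<in>vb_frames E. openin (mtop M) V \<and>
        (\<forall>p\<in>V. inj_on (\<lambda>i. e i p) {..<vb_rank E} \<and>
                independent ((\<lambda>i. e i p) ` {..<vb_rank E}) \<and>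
                span ((\<lambda>i. e i p) ` {..<vb_rank E}) = vb_fibre E p)) \<and>
     (\<forall>(V, e)\<in>vb_frames E. \<forall>(V', e')\<in>vb_frames E. \<forall>j<vb_rank E.
        smooth_in_frame M (vb_rank E) (V \<inter> V') e (e' j))"

text \<open>Sections are extended by zero outside the base, so that they are determined by their values on it.\<close>

definition vb_sections ::
  "('m, 'e::euclidean_space) mfd \<Rightarrow> ('m, 'v::real_vector, 'z) vbundle_scheme \<Rightarrow> ('m \<Rightarrow> 'v) set" where
  "vb_sections M E =
     {s. (\<forall>p\<in>vb_base E. s p \<in> vb_fibre E p) \<and> (\<forall>p. p \<notin> vb_base E \<longrightarrow> s p = 0) \<and>
         (\<forall>(V, e)\<in>vb_frames E. smooth_in_frame M (vb_rank E) V e s)}"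

text \<open>The dual of a subspace \<open>S\<close>; its elements are extended by zero outside \<open>S\<close>.\<close>

definition dual_space :: "'v::real_vector set \<Rightarrow> ('v \<Rightarrow> real) set" where
  "dual_space S =
     {\<alpha>. (\<forall>u\<in>S. \<forall>v\<in>S. \<alpha> (u + v) = \<alpha> u + \<alpha> v) \<and> (\<forall>c. \<forall>u\<in>S. \<alpha> (c *\<^sub>R u) = c * \<alpha> u) \<and>
         (\<forall>u. u \<notin> S \<longrightarrow> \<alpha> u = 0)}"

text \<open>Elements of the second and third exterior power of \<open>S\<close> are alternating forms on \<open>dual_space S\<close>.\<close>

definition bivector_on ::
  "'v::real_vector set \<Rightarrow> (('v \<Rightarrow> real) \<Rightarrow> ('v \<Rightarrow> real) \<Rightarrow> real) \<Rightarrow> bool" where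
  "bivector_on S P \<longleftrightarrow>
     (\<forall>\<alpha>\<in>dual_space S. \<forall>\<beta>\<in>dual_space S. \<forall>\<gamma>\<in>dual_space S. \<forall>a b.
        P (\<lambda>v. a * \<alpha> v + b * \<beta> v) \<gamma> = a * P \<alpha> \<gamma> + b * P \<beta> \<gamma> \<and>
        P \<gamma> (\<lambda>v. a * \<alpha> v + b * \<beta> v) = a * P \<gamma> \<alpha> + b * P \<gamma> \<beta>) \<and>
     (\<forall>\<alpha>\<in>dual_space S. P \<alpha> \<alpha> = 0)"

definition wedge2 :: "'v \<Rightarrow> 'v \<Rightarrow> ('v \<Rightarrow> real) \<Rightarrow> ('v \<Rightarrow> real) \<Rightarrow> real" where
  "wedge2 u v \<alpha> \<beta> = \<alpha> u * \<beta> v - \<alpha> v * \<beta> u"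

definition wedge3 :: "'v \<Rightarrow> 'v \<Rightarrow> 'v \<Rightarrow> ('v \<Rightarrow> real) \<Rightarrow> ('v \<Rightarrow> real) \<Rightarrow> ('v \<Rightarrow> real) \<Rightarrow> real" where
  "wedge3 u v w \<alpha> \<beta> \<gamma> =
     \<alpha> u * (\<beta> v * \<gamma> w - \<beta> w * \<gamma> v)
   - \<alpha> v * (\<beta> u * \<gamma> w - \<beta> w * \<gamma> u)
   + \<alpha> w * (\<beta> u * \<gamma> v - \<beta> v * \<gamma> u)"

definition sharp ::
  "'v::real_vector set \<Rightarrow> (('v \<Rightarrow> real) \<Rightarrow> ('v \<Rightarrow> real) \<Rightarrow> real) \<Rightarrow> ('v \<Rightarrow> real) \<Rightarrow> 'v" where
  "sharp S P \<alpha> = (THE v. v \<in> S \<and> (\<forall>\<beta>\<in>dual_space S. \<beta> v = P \<alpha> \<beta>))"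

type_synonym ('m, 'v) vb_bivector = "'m \<Rightarrow> ('v \<Rightarrow> real) \<Rightarrow> ('v \<Rightarrow> real) \<Rightarrow> real"
type_synonym ('m, 'v) vb_trivector = "'m \<Rightarrow> ('v \<Rightarrow> real) \<Rightarrow> ('v \<Rightarrow> real) \<Rightarrow> ('v \<Rightarrow> real) \<Rightarrow> real"

definition smooth_vb_bivector ::
  "('m, 'e::euclidean_space) mfd \<Rightarrow> ('m, 'v::real_vector, 'z) vbundle_scheme \<Rightarrow> ('m, 'v) vb_bivector \<Rightarrow> bool" where
  "smooth_vb_bivector M E P \<longleftrightarrow>
     (\<forall>p\<in>vb_base E. bivector_on (vb_fibre E p) (P p)) \<and>
     (\<forall>(V, e)\<in>vb_frames E. \<exists>c.
        (\<forall>i<vb_rank E. \<forall>j<vb_rank E. smooth_fun M V (c i j)) \<and>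
        (\<forall>p\<in>V. \<forall>\<alpha>\<in>dual_space (vb_fibre E p). \<forall>\<beta>\<in>dual_space (vb_fibre E p).
           P p \<alpha> \<beta> = (\<Sum>i<vb_rank E. \<Sum>j<vb_rank E. c i j p * \<alpha> (e i p) * \<beta> (e j p))))"

definition vb_nondegenerate :: "('m, 'v::real_vector, 'z) vbundle_scheme \<Rightarrow> ('m, 'v) vb_bivector \<Rightarrow> bool" where
  "vb_nondegenerate E P \<longleftrightarrow>
     (\<forall>p\<in>vb_base E. bij_betw (sharp (vb_fibre E p) (P p)) (dual_space (vb_fibre E p)) (vb_fibre E p))"


section \<open>Lie algebroids\<close>

record ('m, 'v, 'e) lie_algebroid = "('m, 'v) vbundle" +
  la_anchor :: "'m \<Rightarrow> 'v \<Rightarrow> 'e"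
  la_bracket :: "('m \<Rightarrow> 'v) \<Rightarrow> ('m \<Rightarrow> 'v) \<Rightarrow> ('m \<Rightarrow> 'v)"

definition smooth_anchor ::
  "('m, 'e::euclidean_space) mfd \<Rightarrow> ('m, 'v::real_vector, 'e) lie_algebroid \<Rightarrow> bool" where
  "smooth_anchor M A \<longleftrightarrow>
     (\<forall>p\<in>vb_base A. \<forall>u\<in>vb_fibre A p. \<forall>v\<in>vb_fibre A p. \<forall>a b.
        la_anchor A p (a *\<^sub>R u + b *\<^sub>R v) = a *\<^sub>R la_anchor A p u + b *\<^sub>R la_anchor A p v) \<and>
     (\<forall>(V, e)\<in>vb_frames A. \<forall>i<vb_rank A. smooth_vector_field M V (\<lambda>p. la_anchor A p (e i p)))"

definition section_lie_bracket ::
  "('m, 'e::euclidean_space) mfd \<Rightarrow> ('m, 'v::real_vector, 'e) lie_algebroid \<Rightarrow> bool" where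
  "section_lie_bracket M A \<longleftrightarrow> (let \<Gamma> = vb_sections M A; br = la_bracket A in
     (\<forall>s\<in>\<Gamma>. \<forall>t\<in>\<Gamma>. br s t \<in> \<Gamma>) \<and>
     (\<forall>s\<in>\<Gamma>. \<forall>t\<in>\<Gamma>. \<forall>u\<in>\<Gamma>. \<forall>a b.
        br (\<lambda>p. a *\<^sub>R s p + b *\<^sub>R t p) u = (\<lambda>p. a *\<^sub>R br s u p + b *\<^sub>R br t u p) \<and>
        br u (\<lambda>p. a *\<^sub>R s p + b *\<^sub>R t p) = (\<lambda>p. a *\<^sub>R br u s p + b *\<^sub>R br u t p)) \<and>
     (\<forall>s\<in>\<Gamma>. br s s = (\<lambda>p. 0)) \<and>
     (\<forall>s\<in>\<Gamma>. \<forall>t\<in>\<Gamma>. \<forall>u\<in>\<Gamma>. \<forall>p. br s (br t u) p + br t (br u s) p + br u (br s t) p = 0))"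

definition leibniz_rule ::
  "('m, 'e::euclidean_space) mfd \<Rightarrow> ('m, 'v::real_vector, 'e) lie_algebroid \<Rightarrow> bool" where
  "leibniz_rule M A \<longleftrightarrow>
     (\<forall>s\<in>vb_sections M A. \<forall>t\<in>vb_sections M A. \<forall>f. smooth_fun M (vb_base A) f \<longrightarrow>
        (\<forall>p\<in>vb_base A. la_bracket A s (\<lambda>q. f q *\<^sub>R t q) p =
           f p *\<^sub>R la_bracket A s t p + blinfun_apply (differential M f p) (la_anchor A p (s p)) *\<^sub>R t p))"

definition is_lie_algebroid ::
  "('m, 'e::euclidean_space) mfd \<Rightarrow> ('m, 'v::real_vector, 'e) lie_algebroid \<Rightarrow> bool" where
  "is_lie_algebroid M A \<longleftrightarrow>
     smooth_vbundle M A \<and> smooth_anchor M A \<and> section_lie_bracket M A \<and> leibniz_rule M A"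

definition almost_injective ::
  "('m, 'e::euclidean_space) mfd \<Rightarrow> ('m, 'v::real_vector, 'e) lie_algebroid \<Rightarrow> bool" where
  "almost_injective M A \<longleftrightarrow>
     (\<exists>W. openin (mtop M) W \<and> W \<subseteq> vb_base A \<and> vb_base A \<subseteq> mtop M closure_of W \<and>
          (\<forall>p\<in>W. inj_on (la_anchor A p) (vb_fibre A p)))"

text \<open>
  The Schouten-Nijenhuis bracket of bivectors \<open>P\<close>, \<open>Q\<close> is the trivector \<open>T\<close> determined by
  \<open>[a \<and> b, c \<and> d] = [a,c] \<and> b \<and> d - [a,d] \<and> b \<and> c - [b,c] \<and> a \<and> d + [b,d] \<and> a \<and> c\<close>
  together with biadditivity and locality: the formula is required on every open set on which \<open>P\<close> and \<open>Q\<close>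
  are written as sums of decomposable bivectors. Every point has a neighbourhood with such
  decompositions, so \<open>T\<close> is unique on the base.
\<close>

definition bivector_decomposition ::
  "('m, 'e::euclidean_space) mfd \<Rightarrow> ('m, 'v::real_vector, 'e) lie_algebroid \<Rightarrow> 'm set \<Rightarrow>
    ('m, 'v) vb_bivector \<Rightarrow> nat \<Rightarrow> (nat \<Rightarrow> 'm \<Rightarrow> 'v) \<Rightarrow> (nat \<Rightarrow> 'm \<Rightarrow> 'v) \<Rightarrow> bool" where
  "bivector_decomposition M A W P n a b \<longleftrightarrow>
     (\<forall>i<n. a i \<in> vb_sections M A \<and> b i \<in> vb_sections M A) \<and>
     (\<forall>p\<in>W. \<forall>\<alpha>\<in>dual_space (vb_fibre A p). \<forall>\<beta>\<in>dual_space (vb_fibre A p).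
        P p \<alpha> \<beta> = (\<Sum>i<n. wedge2 (a i p) (b i p) \<alpha> \<beta>))"

definition is_schouten_bracket ::
  "('m, 'e::euclidean_space) mfd \<Rightarrow> ('m, 'v::real_vector, 'e) lie_algebroid \<Rightarrow>
    ('m, 'v) vb_bivector \<Rightarrow> ('m, 'v) vb_bivector \<Rightarrow> ('m, 'v) vb_trivector \<Rightarrow> bool" where
  "is_schouten_bracket M A P Q T \<longleftrightarrow> (let br = la_bracket A in
     \<forall>W m n a b c d. openin (mtop M) W \<and> W \<subseteq> vb_base A \<and>
       bivector_decomposition M A W P m a b \<and> bivector_decomposition M A W Q n c d \<longrightarrow>
       (\<forall>p\<in>W. \<forall>\<alpha>\<in>dual_space (vb_fibre A p). \<forall>\<beta>\<in>dual_space (vb_fibre A p).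
        \<forall>\<gamma>\<in>dual_space (vb_fibre A p).
          T p \<alpha> \<beta> \<gamma> = (\<Sum>i<m. \<Sum>j<n.
              wedge3 (br (a i) (c j) p) (b i p) (d j p) \<alpha> \<beta> \<gamma>
            - wedge3 (br (a i) (d j) p) (b i p) (c j p) \<alpha> \<beta> \<gamma>
            - wedge3 (br (b i) (c j) p) (a i p) (d j p) \<alpha> \<beta> \<gamma>
            + wedge3 (br (b i) (d j) p) (a i p) (c j p) \<alpha> \<beta> \<gamma>)))"

definition symplectic_lie_algebroid ::
  "('m, 'e::euclidean_space) mfd \<Rightarrow> ('m, 'v::real_vector, 'e) lie_algebroid \<Rightarrow> ('m, 'v) vb_bivector \<Rightarrow> bool" where
  "symplectic_lie_algebroid M A P \<longleftrightarrow>
     is_lie_algebroid M A \<and> smooth_vb_bivector M A P \<and> vb_nondegenerate A P \<and>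
     is_schouten_bracket M A P P (\<lambda>p \<alpha> \<beta> \<gamma>. 0)"

definition anchor_transpose ::
  "('m, 'v::real_vector, 'e::euclidean_space) lie_algebroid \<Rightarrow> 'm \<Rightarrow> ('e \<Rightarrow>\<^sub>L real) \<Rightarrow> 'v \<Rightarrow> real" where
  "anchor_transpose A p \<xi> = (\<lambda>v. if v \<in> vb_fibre A p then blinfun_apply \<xi> (la_anchor A p v) else 0)"

text \<open>The image of a bivector under the second exterior power of the anchor.\<close>

definition anchor_pushforward ::
  "('m, 'v::real_vector, 'e::euclidean_space) lie_algebroid \<Rightarrow> ('m, 'v) vb_bivector \<Rightarrow> ('m, 'e) bivector_field" where
  "anchor_pushforward A P = (\<lambda>p \<xi> \<eta>. P p (anchor_transpose A p \<xi>) (anchor_transpose A p \<eta>))"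

text \<open>
  The type argument is the universe for the fibres of the algebroid. HOL cannot quantify over it
  inside the definition; as a hypothesis of a theorem with free type variable \<^typ>\<open>'v\<close>, the condition
  ranges over algebroids with fibres in any real vector space.
\<close>

definition locally_desingularizable ::
  "'v::real_vector itself \<Rightarrow> ('m, 'e::euclidean_space) mfd \<Rightarrow> ('m, 'e) bivector_field \<Rightarrow> 'm \<Rightarrow> bool" where
  "locally_desingularizable TY M \<pi> x \<longleftrightarrow>
     (\<exists>(A :: ('m, 'v, 'e) lie_algebroid) P.
        x \<in> vb_base A \<and> symplectic_lie_algebroid M A P \<and> almost_injective M A \<and>
        (\<forall>p\<in>vb_base A. anchor_pushforward A P p = \<pi> p))"

end

theory Submission
  imports Defs
begin

text \<open>
  Let \<open>(A, \<rho>, P)\<close> be a symplectic Lie algebroid near \<open>x\<close> that desingularizes \<open>\<pi>\<close>. The ideal is the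
  annihilator of the image of \<open>\<rho>\<^sub>x\<close>, that is, the kernel of the transposed anchor
  \<open>T\<^sub>x\<^sup>*M \<rightarrow> A\<^sub>x\<^sup>*\<close>.

  Let \<open>e\<close> be a local frame of \<open>A\<close> and \<open>c\<close> the coefficient matrix of \<open>P\<close> in it. Then
  \<open>{f, g} = \<Sum> c\<^sub>i\<^sub>j (\<rho>(e\<^sub>i) f) (\<rho>(e\<^sub>j) g)\<close>. If \<open>d\<^sub>xf\<close> and \<open>d\<^sub>xg\<close> annihilate the image of \<open>\<rho>\<^sub>x\<close>,
  both factors vanish at \<open>x\<close>, so \<open>{f, g}\<close> vanishes to second order and the annihilator is abelian
  (\<open>anchor_annihilator_abelian\<close>).

  The same formula reads \<open>{f, g} = \<rho>(s) g\<close> with the Hamiltonian section \<open>s\<close> of \<open>f\<close>, and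
  \<open>\<rho>\<^sub>x(s\<^sub>x) = 0\<close> because \<open>\<pi>\<^sub>x = 0\<close>. The anchor respects brackets (\<open>anchor_bracket\<close>), so every
  section \<open>a\<close> satisfies \<open>\<rho>(a) {f, g} = \<rho>(s) \<rho>(a) g + \<rho>([a, s]) g\<close>. At \<open>x\<close> the first term
  vanishes, and so does the second if \<open>d\<^sub>xg\<close> annihilates the image of \<open>\<rho>\<^sub>x\<close>. Hence the annihilator is
  an ideal (\<open>anchor_annihilator_ideal\<close>).

  If the annihilator were zero, \<open>\<rho>\<^sub>x\<close> would be onto. Almost-injectivity bounds the rank of \<open>A\<close> by
  the dimension of \<open>M\<close>, so \<open>\<rho>\<^sub>x\<close> would be an isomorphism, and \<open>\<pi>\<^sub>x = 0\<close> would force \<open>P\<^sub>x = 0\<close>.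
  As \<open>M\<close> has positive dimension, this contradicts nondegeneracy (\<open>anchor_annihilator_nonzero\<close>).

  Functions and sections are global objects here, while the argument is local. Cut-off functions
  mediate: they extend local sections to global ones, they realize every covector at \<open>x\<close> as the
  differential of a global function, and with the expression of \<open>\<pi>\<close> in a chart they identify the
  bracket of \<open>T\<^sub>x\<^sup>*M\<close> (\<open>isotropy_bracket_eq\<close>).
\<close>

section \<open>Calculus of smooth functions\<close>

lemma frechet_derivative_cong_open:
  assumes "open S" "x \<in> S" "\<And>y. y \<in> S \<Longrightarrow> f y = g y"
  shows "frechet_derivative f (at x) = frechet_derivative g (at x)"
proof -
  have "(f has_derivative D) (at x) \<longleftrightarrow> (g has_derivative D) (at x)" for D
    using assms by (metis has_derivative_transform_within_open)
  thus ?thesis by (simp add: frechet_derivative_def)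
qed

lemma Ck_on_cong:
  assumes "open S" "\<And>x. x \<in> S \<Longrightarrow> f x = g x"
  shows "Ck_on k S f \<longleftrightarrow> Ck_on k S g"
  using assms(2)
proof (induction k arbitrary: f g)
  case 0
  thus ?case by (simp cong: continuous_on_cong)
next
  case (Suc k)
  have fd: "frechet_derivative f (at x) = frechet_derivative g (at x)" if "x \<in> S" for x
    using frechet_derivative_cong_open[OF assms(1) that] Suc.prems by blast
  have "f differentiable (at x) \<longleftrightarrow> g differentiable (at x)" if "x \<in> S" for x
    using Suc.prems that assms(1) unfolding differentiable_def
    by (metis has_derivative_transform_within_open)
  moreover have "Ck_on k S (\<lambda>x. frechet_derivative f (at x) v) \<longleftrightarrow>
      Ck_on k S (\<lambda>x. frechet_derivative g (at x) v)" for v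
    by (rule Suc.IH) (simp add: fd)
  ultimately show ?case by simp
qed

lemma Ck_on_has_derivativeI:
  assumes "\<And>x. x \<in> S \<Longrightarrow> (f has_derivative f' x) (at x)"
    and "open S" "\<And>v. Ck_on k S (\<lambda>x. f' x v)"
  shows "Ck_on (Suc k) S f"
proof -
  have "frechet_derivative f (at x) = f' x" if "x \<in> S" for x
    using assms(1)[OF that] frechet_derivative_at by metis
  hence "Ck_on k S (\<lambda>x. frechet_derivative f (at x) v)" for v
    using assms(3)[of v] Ck_on_cong[OF assms(2), of "\<lambda>x. frechet_derivative f (at x) v" "\<lambda>x. f' x v"]
    by simp
  thus ?thesis
    using assms(1) by (auto simp: differentiable_def)
qed

lemma Ck_on_has_derivative:
  "Ck_on (Suc k) S f \<Longrightarrow> x \<in> S \<Longrightarrow> (f has_derivative frechet_derivative f (at x)) (at x)"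
  by (simp add: frechet_derivative_works[symmetric])

lemma Ck_on_Suc_imp: "Ck_on (Suc k) S f \<Longrightarrow> Ck_on k S f"
proof (induction k arbitrary: f)
  case 0
  thus ?case
    by (auto intro!: continuous_at_imp_continuous_on differentiable_imp_continuous_within)
next
  case (Suc k)
  thus ?case by (metis Ck_on.simps(2))
qed

lemma Ck_on_subset: "Ck_on k S f \<Longrightarrow> T \<subseteq> S \<Longrightarrow> Ck_on k T f"
  by (induction k arbitrary: f) (auto intro: continuous_on_subset)

lemma Ck_on_local:
  assumes "\<And>x. x \<in> S \<Longrightarrow> \<exists>T. open T \<and> x \<in> T \<and> Ck_on k T f"
  shows "Ck_on k S f"
  using assms
proof (induction k arbitrary: f)
  case 0
  thus ?case
    by (metis Ck_on.simps(1) continuous_at_imp_continuous_on continuous_on_eq_continuous_at)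
next
  case (Suc k)
  have "Ck_on k S (\<lambda>x. frechet_derivative f (at x) v)" for v
  proof (rule Suc.IH)
    fix x assume "x \<in> S"
    then obtain T where "open T" "x \<in> T" "Ck_on (Suc k) T f" using Suc.prems by blast
    thus "\<exists>T. open T \<and> x \<in> T \<and> Ck_on k T (\<lambda>x. frechet_derivative f (at x) v)" by auto
  qed
  moreover have "f differentiable (at x)" if "x \<in> S" for x
    using Suc.prems[OF that] by auto
  ultimately show ?case by simp
qed

lemma Ck_on_const: "open S \<Longrightarrow> Ck_on k S (\<lambda>x. c)"
proof (induction k arbitrary: c)
  case (Suc k)
  thus ?case by (intro Ck_on_has_derivativeI[where f'="\<lambda>_ _. 0"]) auto
qed simp

lemma Ck_on_add:
  assumes "open S" "Ck_on k S f" "Ck_on k S g"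
  shows "Ck_on k S (\<lambda>x. f x + g x)"
  using assms(2,3)
proof (induction k arbitrary: f g)
  case (Suc k)
  show ?case
    by (rule Ck_on_has_derivativeI[OF has_derivative_add])
      (use Suc assms(1) in \<open>auto intro: Ck_on_has_derivative\<close>)
qed (simp add: continuous_on_add)

lemma (in bounded_linear) Ck_on_compose:
  assumes "open S" "Ck_on k S g"
  shows "Ck_on k S (\<lambda>x. f (g x))"
  using assms(2)
proof (induction k arbitrary: g)
  case 0
  thus ?case by (simp add: continuous_on)
next
  case (Suc k)
  show ?case
    by (rule Ck_on_has_derivativeI[OF has_derivative])
      (use Suc assms(1) in \<open>auto intro: Ck_on_has_derivative\<close>)
qed

lemma (in bounded_bilinear) Ck_on_prod:
  assumes "open S" "Ck_on k S f" "Ck_on k S g"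
  shows "Ck_on k S (\<lambda>x. prod (f x) (g x))"
  using assms(2,3)
proof (induction k arbitrary: f g)
  case 0
  thus ?case by (simp add: continuous_on)
next
  case (Suc k)
  show ?case
  proof (rule Ck_on_has_derivativeI[OF FDERIV])
    fix v
    show "Ck_on k S (\<lambda>x. prod (f x) (frechet_derivative g (at x) v) +
        prod (frechet_derivative f (at x) v) (g x))"
      using Suc Ck_on_Suc_imp[of k S f] Ck_on_Suc_imp[of k S g]
      by (intro Ck_on_add assms(1) Suc.IH) auto
  qed (use Suc assms(1) in \<open>auto intro: Ck_on_has_derivative\<close>)
qed

lemma Ck_on_sum:
  assumes "open S" "\<And>i. i \<in> I \<Longrightarrow> Ck_on k S (f i)"
  shows "Ck_on k S (\<lambda>x. \<Sum>i\<in>I. f i x)"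
  using assms(2)
  by (induction I rule: infinite_finite_induct)
    (auto intro: Ck_on_const Ck_on_add assms(1))

lemma linear_basis_expansion:
  fixes f :: "'a::euclidean_space \<Rightarrow> 'b::real_vector"
  assumes "linear f"
  shows "f v = (\<Sum>b\<in>Basis. (v \<bullet> b) *\<^sub>R f b)"
proof -
  have "f v = f (\<Sum>b\<in>Basis. (v \<bullet> b) *\<^sub>R b)"
    by (simp add: euclidean_representation)
  also have "\<dots> = (\<Sum>b\<in>Basis. (v \<bullet> b) *\<^sub>R f b)"
    by (simp add: linear_sum[OF assms] linear_scale[OF assms])
  finally show ?thesis .
qed

lemma Ck_on_compose:
  fixes f :: "'a::real_normed_vector \<Rightarrow> 'b::euclidean_space"
    and g :: "'b \<Rightarrow> 'c::real_normed_vector"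
  assumes "open S" "open T" "f ` S \<subseteq> T" "Ck_on k S f" "Ck_on k T g"
  shows "Ck_on k S (g \<circ> f)"
  using assms(3-5)
proof (induction k arbitrary: g)
  case 0
  thus ?case by (simp add: continuous_on_compose continuous_on_subset del: o_apply)
next
  case (Suc k)
  define f' where "f' = (\<lambda>x. frechet_derivative f (at x))"
  define g' where "g' = (\<lambda>x. frechet_derivative g (at x))"
  have f': "(f has_derivative f' x) (at x)" if "x \<in> S" for x
    using that Suc.prems unfolding f'_def by (blast intro: Ck_on_has_derivative)
  have g': "(g has_derivative g' y) (at y)" if "y \<in> T" for y
    using that Suc.prems unfolding g'_def by (blast intro: Ck_on_has_derivative)
  have lin: "linear (g' y)" if "y \<in> T" for y
    using g'[OF that] has_derivative_linear by blast
  \<comment> \<open>Only directional derivatives along fixed vectors are known to be \<open>Ck\<close>, so the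
    varying direction \<open>f' x v\<close> is expanded in the basis.\<close>
  have *: "((g \<circ> f) has_derivative (\<lambda>v. \<Sum>b\<in>Basis. (f' x v \<bullet> b) *\<^sub>R g' (f x) b)) (at x)"
    if "x \<in> S" for x
  proof -
    have "f x \<in> T" using that Suc.prems by auto
    hence "((g \<circ> f) has_derivative (g' (f x) \<circ> f' x)) (at x)"
      using diff_chain_at[OF f'[OF that] g'] by blast
    moreover have "g' (f x) \<circ> f' x = (\<lambda>v. \<Sum>b\<in>Basis. (f' x v \<bullet> b) *\<^sub>R g' (f x) b)"
      unfolding o_def by (intro ext linear_basis_expansion[OF lin[OF \<open>f x \<in> T\<close>]])
    ultimately show ?thesis by simp
  qed
  show ?case
  proof (rule Ck_on_has_derivativeI[OF *])
    fix v
    show "Ck_on k S (\<lambda>x. \<Sum>b\<in>Basis. (f' x v \<bullet> b) *\<^sub>R g' (f x) b)"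
    proof (intro Ck_on_sum bounded_bilinear.Ck_on_prod[OF bounded_bilinear_scaleR] assms(1))
      fix b :: 'b
      show "Ck_on k S (\<lambda>x. f' x v \<bullet> b)"
        using Suc.prems unfolding f'_def
        by (intro bounded_linear.Ck_on_compose[OF bounded_linear_inner_left] assms(1)) auto
      have "Ck_on k S ((\<lambda>y. g' y b) \<circ> f)"
        using Suc.prems Ck_on_Suc_imp[of k S f] unfolding g'_def by (intro Suc.IH) auto
      thus "Ck_on k S (\<lambda>x. g' (f x) b)" by (simp add: o_def)
    qed
  qed (use assms in auto)
qed

lemma smooth_on_cong:
  "open S \<Longrightarrow> (\<And>x. x \<in> S \<Longrightarrow> f x = g x) \<Longrightarrow> smooth_on S f \<longleftrightarrow> smooth_on S g"
  unfolding smooth_on_def using Ck_on_cong by blast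

lemma smooth_on_subset: "smooth_on S f \<Longrightarrow> T \<subseteq> S \<Longrightarrow> smooth_on T f"
  unfolding smooth_on_def using Ck_on_subset by blast

lemma smooth_on_local:
  "(\<And>x. x \<in> S \<Longrightarrow> \<exists>T. open T \<and> x \<in> T \<and> smooth_on T f) \<Longrightarrow> smooth_on S f"
  unfolding smooth_on_def by (meson Ck_on_local)

lemma smooth_on_has_derivative:
  "smooth_on S f \<Longrightarrow> x \<in> S \<Longrightarrow> (f has_derivative frechet_derivative f (at x)) (at x)"
  unfolding smooth_on_def by (meson Ck_on_has_derivative)

lemma smooth_on_frechet_derivative:
  "smooth_on S f \<Longrightarrow> smooth_on S (\<lambda>x. frechet_derivative f (at x) v)"
  unfolding smooth_on_def by (metis Ck_on.simps(2))

lemma smooth_on_const: "open S \<Longrightarrow> smooth_on S (\<lambda>x. c)"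
  unfolding smooth_on_def by (simp add: Ck_on_const)

lemma (in bounded_linear) smooth_on_compose:
  "open S \<Longrightarrow> smooth_on S g \<Longrightarrow> smooth_on S (\<lambda>x. f (g x))"
  unfolding smooth_on_def using Ck_on_compose by blast

lemma smooth_on_id: "open S \<Longrightarrow> smooth_on S (\<lambda>x. x)"
  unfolding smooth_on_def
proof
  fix k
  assume "open S"
  thus "Ck_on k S (\<lambda>x. x)"
    by (cases k) (auto intro!: Ck_on_has_derivativeI[where f'="\<lambda>_ v. v"] Ck_on_const simp: continuous_on_id)
qed

lemma smooth_on_add:
  "open S \<Longrightarrow> smooth_on S f \<Longrightarrow> smooth_on S g \<Longrightarrow> smooth_on S (\<lambda>x. f x + g x)"
  unfolding smooth_on_def using Ck_on_add by blast

lemma (in bounded_bilinear) smooth_on_prod: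
  "open S \<Longrightarrow> smooth_on S f \<Longrightarrow> smooth_on S g \<Longrightarrow> smooth_on S (\<lambda>x. prod (f x) (g x))"
  unfolding smooth_on_def using Ck_on_prod by blast

lemma smooth_on_compose:
  fixes f :: "'a::real_normed_vector \<Rightarrow> 'b::euclidean_space"
  shows "open S \<Longrightarrow> open T \<Longrightarrow> f ` S \<subseteq> T \<Longrightarrow> smooth_on S f \<Longrightarrow> smooth_on T g \<Longrightarrow> smooth_on S (g \<circ> f)"
  unfolding smooth_on_def using Ck_on_compose by blast

section \<open>A smooth bump function\<close>

text \<open>
  The member with \<open>n = 0\<close> is the classical smooth function that is flat at \<open>0\<close>. The powers of \<open>1 / t\<close>
  make the family closed under differentiation, so that a single induction on the order of
  differentiability treats all members at once.
\<close>

definition flat_exp :: "nat \<Rightarrow> real \<Rightarrow> real" where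
  "flat_exp n t = (if t > 0 then (1 / t) ^ n * exp (- (1 / t)) else 0)"

lemma flat_exp_tendsto_0: "(flat_exp n \<longlongrightarrow> 0) (at 0)"
proof (rule filterlim_split_at)
  show "(flat_exp n \<longlongrightarrow> 0) (at_left 0)"
    by (rule Lim_transform_eventually[OF tendsto_const])
      (auto simp: eventually_at_left_field flat_exp_def intro!: exI[of _ "-1"])
  have "((\<lambda>y::real. y ^ n / exp y) \<longlongrightarrow> 0) at_top"
    by (rule tendsto_power_div_exp_0)
  hence "((\<lambda>t::real. inverse t ^ n / exp (inverse t)) \<longlongrightarrow> 0) (at_right 0)"
    by (rule filterlim_compose[OF _ filterlim_inverse_at_top_right])
  thus "(flat_exp n \<longlongrightarrow> 0) (at_right 0)"
    by (rule Lim_transform_eventually)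
      (auto simp: eventually_at_right_field flat_exp_def exp_minus field_simps intro!: exI[of _ 1])
qed

text \<open>
  At \<open>0\<close> the difference quotient of one member of the family is the next member, which tends to \<open>0\<close>.
\<close>

lemma flat_exp_derivative:
  "(flat_exp n has_real_derivative flat_exp (n + 2) t - n * flat_exp (n + 1) t) (at t)"
proof -
  consider "t > 0" | "t < 0" | "t = 0" by linarith
  thus ?thesis
  proof cases
    case 1
    have "((\<lambda>t. (1 / t) ^ n * exp (- (1 / t))) has_real_derivative
        flat_exp (n + 2) t - n * flat_exp (n + 1) t) (at t)"
    proof -
      have u: "((\<lambda>t. 1 / t) has_real_derivative - ((1 / t)\<^sup>2)) (at t)"
        using 1 by (auto intro!: derivative_eq_intros simp: power2_eq_square)
      have "((\<lambda>t. (1 / t) ^ n * exp (- (1 / t))) has_real_derivative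
          (of_nat n * (- ((1 / t)\<^sup>2) * (1 / t) ^ (n - Suc 0))) * exp (- (1 / t)) +
          (exp (- (1 / t)) * - (- ((1 / t)\<^sup>2))) * (1 / t) ^ n) (at t)"
        by (intro DERIV_mult DERIV_power DERIV_fun_exp DERIV_minus u)
      thus ?thesis
        using 1 by (cases n) (simp_all add: flat_exp_def power2_eq_square algebra_simps)
    qed
    thus ?thesis
      using 1 by (rule_tac has_field_derivative_transform_within_open[where S="{0<..}"])
        (auto simp: flat_exp_def)
  next
    case 2
    have "((\<lambda>t. 0) has_real_derivative flat_exp (n + 2) t - n * flat_exp (n + 1) t) (at t)"
      using 2 by (simp add: flat_exp_def)
    thus ?thesis
      using 2 by (rule_tac has_field_derivative_transform_within_open[where S="{..<0}"])
        (auto simp: flat_exp_def)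
  next
    case 3
    have "((\<lambda>h. (flat_exp n (0 + h) - flat_exp n 0) / h) \<longlongrightarrow> 0) (at 0)"
      by (rule Lim_transform_eventually[OF flat_exp_tendsto_0[of "Suc n"]])
        (auto simp: flat_exp_def eventually_at_filter)
    thus ?thesis
      using 3 by (simp add: DERIV_def flat_exp_def)
  qed
qed

lemma smooth_on_flat_exp: "smooth_on UNIV (flat_exp n)"
proof -
  have "Ck_on k UNIV (flat_exp n)" for k n
  proof (induction k arbitrary: n)
    case 0
    show ?case
      unfolding Ck_on.simps
      by (intro continuous_at_imp_continuous_on ballI DERIV_isCont[OF flat_exp_derivative])
  next
    case (Suc k)
    show ?case
    proof (rule Ck_on_has_derivativeI)
      fix t
      show "(flat_exp n has_derivative
          (\<lambda>v. (flat_exp (n + 2) t + (- real n) * flat_exp (n + 1) t) * v)) (at t)"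
        using flat_exp_derivative[of n t] by (simp add: has_field_derivative_def)
    next
      fix v
      show "Ck_on k UNIV (\<lambda>t. (flat_exp (n + 2) t + (- real n) * flat_exp (n + 1) t) * v)"
        by (intro bounded_bilinear.Ck_on_prod[OF bounded_bilinear_mult] Ck_on_add Ck_on_const Suc.IH)
          auto
    qed auto
  qed
  thus ?thesis by (simp add: smooth_on_def)
qed

text \<open>
  The quantity \<open>r\<^sup>2 - \<bar>z - y\<bar>\<^sup>2\<close> is positive exactly in the open ball, and the flat function
  annihilates its other values smoothly.
\<close>

lemma smooth_bump_euclidean:
  fixes y :: "'a::euclidean_space"
  assumes "r > 0"
  obtains \<beta> :: "'a \<Rightarrow> real" where "smooth_on UNIV \<beta>" "\<beta> y = 1" "\<And>z. z \<notin> cball y r \<Longrightarrow> \<beta> z = 0"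
proof
  define q where "q = (\<lambda>z. r\<^sup>2 + (- 1) * ((z + (- y)) \<bullet> (z + (- y))))"
  define \<beta> where "\<beta> = (\<lambda>z. (1 / flat_exp 0 (r\<^sup>2)) * flat_exp 0 (q z))"
  have "smooth_on UNIV q"
    unfolding q_def
    by (intro smooth_on_add smooth_on_const smooth_on_id
        bounded_bilinear.smooth_on_prod[OF bounded_bilinear_mult]
        bounded_bilinear.smooth_on_prod[OF bounded_bilinear_inner]) auto
  hence "smooth_on UNIV (flat_exp 0 \<circ> q)"
    by (intro smooth_on_compose[where T=UNIV] smooth_on_flat_exp) auto
  thus "smooth_on UNIV \<beta>"
    unfolding \<beta>_def o_def
    by (intro bounded_bilinear.smooth_on_prod[OF bounded_bilinear_mult] smooth_on_const) auto
  show "\<beta> y = 1" using assms by (simp add: \<beta>_def q_def flat_exp_def)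
  show "\<beta> z = 0" if "z \<notin> cball y r" for z
  proof -
    have "norm (z - y) > r" using that by (simp add: dist_norm norm_minus_commute)
    hence "(norm (z - y))\<^sup>2 > r\<^sup>2" using assms by (intro power_strict_mono) auto
    thus ?thesis by (simp add: \<beta>_def q_def flat_exp_def power2_norm_eq_inner)
  qed
qed

section \<open>Smooth functions on a manifold\<close>

locale smooth_mfd =
  fixes M :: "('m, 'e::euclidean_space) mfd"
  assumes M: "smooth_manifold M"
begin

lemma
  assumes "(D, \<phi>) \<in> atlas M"
  shows chart_openin: "openin (mtop M) D"
    and chart_homeomorphic: "homeomorphic_map (subtopology (mtop M) D) (top_of_set (\<phi> ` D)) \<phi>"
    and chart_inj: "inj_on \<phi> D"
    and chart_open_UNIV: "open (\<phi> ` D)"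
proof -
  have *: "is_chart (mtop M) (D, \<phi>)" using M assms by (auto simp: smooth_manifold_def)
  show "openin (mtop M) D" and h: "homeomorphic_map (subtopology (mtop M) D) (top_of_set (\<phi> ` D)) \<phi>"
    and "open (\<phi> ` D)" using * by (auto simp: is_chart_def)
  moreover have "topspace (subtopology (mtop M) D) = D"
    using \<open>openin (mtop M) D\<close> openin_subset by fastforce
  ultimately show "inj_on \<phi> D" using h homeomorphic_imp_injective_map by fastforce
qed

lemma chart_inverse: "(D, \<phi>) \<in> atlas M \<Longrightarrow> p \<in> D \<Longrightarrow> inv_into D \<phi> (\<phi> p) = p"
  using chart_inj by simp

lemma chart_open_image:
  assumes "(D, \<phi>) \<in> atlas M" "openin (mtop M) W"
  shows "open (\<phi> ` (D \<inter> W))"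
proof -
  have "openin (subtopology (mtop M) D) (D \<inter> W)"
    using assms(2) by (simp add: openin_subtopology_Int2)
  hence "openin (top_of_set (\<phi> ` D)) (\<phi> ` (D \<inter> W))"
    using chart_homeomorphic[OF assms(1)] homeomorphic_imp_open_map open_map_def by blast
  thus ?thesis using chart_open_UNIV[OF assms(1)] openin_open_trans by blast
qed

lemma chart_at_atlas:
  assumes "p \<in> topspace (mtop M)" "chart_at M p = (D, \<phi>)"
  shows "(D, \<phi>) \<in> atlas M" "p \<in> D"
proof -
  have "p \<in> (\<Union>(D, \<phi>)\<in>atlas M. D)" using M assms(1) unfolding smooth_manifold_def by metis
  hence "\<exists>c. c \<in> atlas M \<and> p \<in> fst c" by auto
  hence "chart_at M p \<in> atlas M \<and> p \<in> fst (chart_at M p)"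
    unfolding chart_at_def by (rule someI_ex)
  thus "(D, \<phi>) \<in> atlas M" "p \<in> D" using assms(2) by auto
qed

lemma smooth_fun_openin: "smooth_fun M W f \<Longrightarrow> openin (mtop M) W"
  by (simp add: smooth_fun_def)

lemma smooth_fun_topspace: "smooth_fun M W f \<Longrightarrow> p \<in> W \<Longrightarrow> p \<in> topspace (mtop M)"
  using openin_subset by (auto simp: smooth_fun_def)

lemma smooth_fun_in_chart:
  "smooth_fun M W f \<Longrightarrow> (D, \<phi>) \<in> atlas M \<Longrightarrow> smooth_on (\<phi> ` (D \<inter> W)) (f \<circ> inv_into D \<phi>)"
  by (auto simp: smooth_fun_def)

lemma smooth_funI:
  assumes "openin (mtop M) W"
    and "\<And>D \<phi>. (D, \<phi>) \<in> atlas M \<Longrightarrow> open (\<phi> ` (D \<inter> W)) \<Longrightarrow> smooth_on (\<phi> ` (D \<inter> W)) (f \<circ> inv_into D \<phi>)"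
  shows "smooth_fun M W f"
  using assms chart_open_image by (auto simp: smooth_fun_def)

lemma smooth_fun_cong:
  assumes "smooth_fun M W f" "\<And>p. p \<in> W \<Longrightarrow> f p = g p"
  shows "smooth_fun M W g"
proof (rule smooth_funI)
  show "openin (mtop M) W" using assms(1) by (rule smooth_fun_openin)
  fix D \<phi>
  assume c: "(D, \<phi>) \<in> atlas M" and o: "open (\<phi> ` (D \<inter> W))"
  show "smooth_on (\<phi> ` (D \<inter> W)) (g \<circ> inv_into D \<phi>)"
    using smooth_on_cong[OF o, of "f \<circ> inv_into D \<phi>" "g \<circ> inv_into D \<phi>"]
      smooth_fun_in_chart[OF assms(1) c] assms(2) chart_inverse[OF c] by force
qed

lemma smooth_fun_subset:
  assumes "smooth_fun M W f" "openin (mtop M) W'" "W' \<subseteq> W"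
  shows "smooth_fun M W' f"
proof (rule smooth_funI[OF assms(2)])
  fix D \<phi>
  assume "(D, \<phi>) \<in> atlas M"
  from smooth_fun_in_chart[OF assms(1) this] show "smooth_on (\<phi> ` (D \<inter> W')) (f \<circ> inv_into D \<phi>)"
    by (rule smooth_on_subset) (use assms(3) in auto)
qed

text \<open>
  Lets smoothness be checked in a different chart or frame around each point.
\<close>

lemma smooth_fun_local:
  assumes "\<And>p. p \<in> W \<Longrightarrow> \<exists>W'. p \<in> W' \<and> W' \<subseteq> W \<and> smooth_fun M W' f"
  shows "smooth_fun M W f"
proof (rule smooth_funI)
  show "openin (mtop M) W" using assms smooth_fun_openin by (subst openin_subopen) blast
  fix D \<phi>
  assume c: "(D, \<phi>) \<in> atlas M"
  show "smooth_on (\<phi> ` (D \<inter> W)) (f \<circ> inv_into D \<phi>)"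
  proof (rule smooth_on_local)
    fix y
    assume "y \<in> \<phi> ` (D \<inter> W)"
    then obtain p where p: "p \<in> D" "p \<in> W" "y = \<phi> p" by auto
    obtain W' where W': "p \<in> W'" "W' \<subseteq> W" "smooth_fun M W' f" using assms[OF p(2)] by auto
    thus "\<exists>T. open T \<and> y \<in> T \<and> smooth_on T (f \<circ> inv_into D \<phi>)"
      using smooth_fun_in_chart[OF W'(3) c] chart_open_image[OF c smooth_fun_openin[OF W'(3)]] p by blast
  qed
qed

lemma smooth_fun_const: "openin (mtop M) W \<Longrightarrow> smooth_fun M W (\<lambda>p. c)"
  by (rule smooth_funI) (simp_all add: o_def smooth_on_const)

lemma smooth_fun_add:
  "smooth_fun M W f \<Longrightarrow> smooth_fun M W g \<Longrightarrow> smooth_fun M W (\<lambda>p. f p + g p)"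
  by (rule smooth_funI)
    (auto simp: o_def smooth_fun_openin intro: smooth_on_add dest: smooth_fun_in_chart[unfolded o_def])

lemma smooth_fun_bounded_linear:
  "bounded_linear L \<Longrightarrow> smooth_fun M W f \<Longrightarrow> smooth_fun M W (\<lambda>p. L (f p))"
  by (rule smooth_funI)
    (auto simp: o_def smooth_fun_openin intro: bounded_linear.smooth_on_compose dest: smooth_fun_in_chart[unfolded o_def])

lemma smooth_fun_bounded_bilinear:
  "bounded_bilinear B \<Longrightarrow> smooth_fun M W f \<Longrightarrow> smooth_fun M W g \<Longrightarrow> smooth_fun M W (\<lambda>p. B (f p) (g p))"
  by (rule smooth_funI)
    (auto simp: o_def smooth_fun_openin intro: bounded_bilinear.smooth_on_prod dest: smooth_fun_in_chart[unfolded o_def])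

lemmas smooth_fun_mult = smooth_fun_bounded_bilinear[OF bounded_bilinear_mult]
lemmas smooth_fun_inner_left = smooth_fun_bounded_linear[OF bounded_linear_inner_left]

lemma smooth_fun_sum:
  "openin (mtop M) W \<Longrightarrow> (\<And>i. i \<in> I \<Longrightarrow> smooth_fun M W (f i)) \<Longrightarrow> smooth_fun M W (\<lambda>p. \<Sum>i\<in>I. f i p)"
  by (induction I rule: infinite_finite_induct) (auto intro: smooth_fun_const smooth_fun_add)

lemma smooth_fun_compose:
  fixes f :: "'m \<Rightarrow> 'b::euclidean_space"
  assumes "smooth_fun M W f" "open T" "f ` W \<subseteq> T" "smooth_on T g"
  shows "smooth_fun M W (\<lambda>p. g (f p))"
proof (rule smooth_funI)
  show "openin (mtop M) W" using assms(1) by (rule smooth_fun_openin)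
  fix D \<phi>
  assume c: "(D, \<phi>) \<in> atlas M" and o: "open (\<phi> ` (D \<inter> W))"
  have "smooth_on (\<phi> ` (D \<inter> W)) (g \<circ> (f \<circ> inv_into D \<phi>))"
    using assms(2-4) chart_inverse[OF c]
    by (intro smooth_on_compose[OF o assms(2)] smooth_fun_in_chart[OF assms(1) c]) auto
  thus "smooth_on (\<phi> ` (D \<inter> W)) ((\<lambda>p. g (f p)) \<circ> inv_into D \<phi>)" by (simp add: o_def)
qed

lemma smooth_fun_chart: "(D, \<phi>) \<in> atlas M \<Longrightarrow> smooth_fun M D \<phi>"
proof (rule smooth_funI)
  fix D' \<psi>
  assume c: "(D, \<phi>) \<in> atlas M" and c': "(D', \<psi>) \<in> atlas M"
  have *: "\<forall>(D, \<phi>)\<in>atlas M. \<forall>(D', \<psi>)\<in>atlas M. smooth_on (\<phi> ` (D \<inter> D')) (\<psi> \<circ> inv_into D \<phi>)"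
    using M by (simp add: smooth_manifold_def)
  show "smooth_on (\<psi> ` (D' \<inter> D)) (\<phi> \<circ> inv_into D' \<psi>)"
    using bspec[OF bspec[OF * c', unfolded prod.case] c] by simp
qed (rule chart_openin)

section \<open>Differentials\<close>

lemma differential_eqI:
  assumes "chart_at M p = (D, \<phi>)" "((f \<circ> inv_into D \<phi>) has_derivative F) (at (\<phi> p))"
  shows "blinfun_apply (differential M f p) = F"
  using assms frechet_derivative_at[OF assms(2)] has_derivative_bounded_linear[OF assms(2)]
  by (simp add: differential_def bounded_linear_Blinfun_apply)

lemma differential_has_derivative:
  assumes "smooth_fun M W f" "p \<in> W" "chart_at M p = (D, \<phi>)"
  shows "((f \<circ> inv_into D \<phi>) has_derivative blinfun_apply (differential M f p)) (at (\<phi> p))"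
proof -
  have "p \<in> topspace (mtop M)" using assms(1,2) smooth_fun_topspace by blast
  note c = chart_at_atlas[OF this assms(3)]
  have "((f \<circ> inv_into D \<phi>) has_derivative frechet_derivative (f \<circ> inv_into D \<phi>) (at (\<phi> p))) (at (\<phi> p))"
    using smooth_fun_in_chart[OF assms(1) c(1)] c(2) assms(2) by (blast intro: smooth_on_has_derivative)
  moreover from this have "blinfun_apply (differential M f p) =
      frechet_derivative (f \<circ> inv_into D \<phi>) (at (\<phi> p))"
    by (rule differential_eqI[OF assms(3)])
  ultimately show ?thesis by (simp only:)
qed

lemma differential_cong:
  assumes "openin (mtop M) W" "p \<in> W" "\<And>q. q \<in> W \<Longrightarrow> f q = g q"
  shows "differential M f p = differential M g p"
proof -
  obtain D \<phi> where c: "chart_at M p = (D, \<phi>)" by (cases "chart_at M p")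
  have "p \<in> topspace (mtop M)" using assms(1,2) openin_subset by blast
  note c' = chart_at_atlas[OF this c]
  have "frechet_derivative (f \<circ> inv_into D \<phi>) (at (\<phi> p)) = frechet_derivative (g \<circ> inv_into D \<phi>) (at (\<phi> p))"
    using chart_open_image[OF c'(1) assms(1)] c'(2) assms(2,3) chart_inverse[OF c'(1)]
    by (intro frechet_derivative_cong_open[of "\<phi> ` (D \<inter> W)"]) auto
  thus ?thesis by (simp add: differential_def c)
qed

lemma differential_const: "differential M (\<lambda>q. c) p = 0"
proof -
  obtain D \<phi> where c: "chart_at M p = (D, \<phi>)" by (cases "chart_at M p")
  have "blinfun_apply (differential M (\<lambda>q. c) p) = (\<lambda>v. 0)"
    by (rule differential_eqI[OF c]) (simp add: o_def)
  thus ?thesis by (intro blinfun_eqI) simp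
qed

lemma differential_add:
  assumes "smooth_fun M W f" "smooth_fun M W g" "p \<in> W"
  shows "differential M (\<lambda>q. f q + g q) p = differential M f p + differential M g p"
proof -
  obtain D \<phi> where c: "chart_at M p = (D, \<phi>)" by (cases "chart_at M p")
  have "blinfun_apply (differential M (\<lambda>q. f q + g q) p) = (\<lambda>v. differential M f p v + differential M g p v)"
    by (rule differential_eqI[OF c])
      (use has_derivative_add[OF differential_has_derivative[OF assms(1,3) c]
        differential_has_derivative[OF assms(2,3) c]] in \<open>simp add: o_def\<close>)
  thus ?thesis by (intro blinfun_eqI) (simp add: blinfun.add_left)
qed

lemma differential_sum:
  assumes "openin (mtop M) W" "p \<in> W" "\<And>i. i \<in> I \<Longrightarrow> smooth_fun M W (f i)"
  shows "differential M (\<lambda>q. \<Sum>i\<in>I. f i q) p = (\<Sum>i\<in>I. differential M (f i) p)"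
  using assms(3)
proof (induction I rule: infinite_finite_induct)
  case (insert i I)
  have "differential M (\<lambda>q. f i q + (\<Sum>i\<in>I. f i q)) p =
      differential M (f i) p + differential M (\<lambda>q. \<Sum>i\<in>I. f i q) p"
    by (intro differential_add[OF _ _ assms(2)] smooth_fun_sum assms(1)) (use insert.prems in auto)
  also have "\<dots> = differential M (f i) p + (\<Sum>i\<in>I. differential M (f i) p)"
    using insert.IH insert.prems by simp
  finally show ?case using insert.hyps by simp
qed (simp_all add: differential_const)

lemma differential_bounded_linear:
  assumes "bounded_linear L" "smooth_fun M W f" "p \<in> W"
  shows "differential M (\<lambda>q. L (f q)) p v = L (differential M f p v)"
proof -
  obtain D \<phi> where c: "chart_at M p = (D, \<phi>)" by (cases "chart_at M p")
  have "blinfun_apply (differential M (\<lambda>q. L (f q)) p) = (\<lambda>v. L (differential M f p v))"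
    by (rule differential_eqI[OF c])
      (use bounded_linear.has_derivative[OF assms(1) differential_has_derivative[OF assms(2,3) c]]
        in \<open>simp add: o_def\<close>)
  thus ?thesis by simp
qed

lemma differential_mult:
  fixes f g :: "'m \<Rightarrow> real"
  assumes "smooth_fun M W f" "smooth_fun M W g" "p \<in> W"
  shows "differential M (\<lambda>q. f q * g q) p = f p *\<^sub>R differential M g p + g p *\<^sub>R differential M f p"
proof -
  obtain D \<phi> where c: "chart_at M p = (D, \<phi>)" by (cases "chart_at M p")
  have "p \<in> topspace (mtop M)" using assms(1,3) smooth_fun_topspace by blast
  note c' = chart_at_atlas[OF this c]
  have "blinfun_apply (differential M (\<lambda>q. f q * g q) p) =
      (\<lambda>v. f p * differential M g p v + differential M f p v * g p)"
    by (rule differential_eqI[OF c])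
      (use has_derivative_mult[OF differential_has_derivative[OF assms(1,3) c]
        differential_has_derivative[OF assms(2,3) c]] in \<open>simp add: o_def chart_inverse[OF c']\<close>)
  thus ?thesis by (intro blinfun_eqI) (simp add: blinfun.add_left blinfun.scaleR_left mult.commute)
qed

text \<open>
  A differential at \<open>p\<close> is read in the distinguished chart of \<open>p\<close>, which may vary wildly with \<open>p\<close>. The
  chain rule trades it for a fixed chart, where dependence on \<open>p\<close> can be smooth.
\<close>

lemma differential_in_chart:
  assumes "(D, \<phi>) \<in> atlas M" "smooth_fun M W f" "p \<in> D \<inter> W"
  shows "differential M f p v =
    frechet_derivative (f \<circ> inv_into D \<phi>) (at (\<phi> p)) (differential M \<phi> p v)"
proof -
  obtain D0 \<phi>0 where c: "chart_at M p = (D0, \<phi>0)" by (cases "chart_at M p")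
  have "p \<in> topspace (mtop M)" using assms(2,3) smooth_fun_topspace by blast
  note c' = chart_at_atlas[OF this c]
  have f: "((f \<circ> inv_into D \<phi>) has_derivative frechet_derivative (f \<circ> inv_into D \<phi>) (at (\<phi> p))) (at (\<phi> p))"
    using smooth_fun_in_chart[OF assms(2,1)] assms(3) by (blast intro: smooth_on_has_derivative)
  have \<phi>: "((\<phi> \<circ> inv_into D0 \<phi>0) has_derivative blinfun_apply (differential M \<phi> p)) (at (\<phi>0 p))"
    using differential_has_derivative[OF smooth_fun_chart[OF assms(1)] _ c] assms(3) by blast
  have "((f \<circ> inv_into D \<phi>) \<circ> (\<phi> \<circ> inv_into D0 \<phi>0) has_derivative
      frechet_derivative (f \<circ> inv_into D \<phi>) (at (\<phi> p)) \<circ> blinfun_apply (differential M \<phi> p)) (at (\<phi>0 p))"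
    by (rule diff_chain_at[OF \<phi>]) (use f chart_inverse[OF c'] in simp)
  hence "((f \<circ> inv_into D0 \<phi>0) has_derivative
      frechet_derivative (f \<circ> inv_into D \<phi>) (at (\<phi> p)) \<circ> blinfun_apply (differential M \<phi> p)) (at (\<phi>0 p))"
    by (rule has_derivative_transform_within_open[OF _ chart_open_image[OF c'(1) chart_openin[OF assms(1)]]])
      (use assms(3) c' chart_inverse[OF assms(1)] chart_inverse[OF c'(1)] in auto)
  from differential_eqI[OF c this] show ?thesis by simp
qed

lemma smooth_fun_frechet_derivative_in_chart:
  assumes "(D, \<phi>) \<in> atlas M" "smooth_fun M W f"
  shows "smooth_fun M (D \<inter> W) (\<lambda>p. frechet_derivative (f \<circ> inv_into D \<phi>) (at (\<phi> p)) b)"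
proof -
  have o: "openin (mtop M) (D \<inter> W)"
    using chart_openin[OF assms(1)] smooth_fun_openin[OF assms(2)] by blast
  show ?thesis
    by (rule smooth_fun_compose[OF smooth_fun_subset[OF smooth_fun_chart[OF assms(1)] o]
          chart_open_image[OF assms(1) smooth_fun_openin[OF assms(2)]]])
      (use smooth_on_frechet_derivative[OF smooth_fun_in_chart[OF assms(2,1)]] in blast)+
qed

lemma differential_expansion:
  fixes f :: "'m \<Rightarrow> real"
  assumes "(D, \<phi>) \<in> atlas M" "smooth_fun M W f" "p \<in> D \<inter> W"
  shows "differential M f p = (\<Sum>b\<in>Basis. frechet_derivative (f \<circ> inv_into D \<phi>) (at (\<phi> p)) b *\<^sub>R
    differential M (\<lambda>q. \<phi> q \<bullet> b) p)"
proof (rule blinfun_eqI)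
  fix v
  have lin: "linear (frechet_derivative (f \<circ> inv_into D \<phi>) (at (\<phi> p)))"
    using smooth_fun_in_chart[OF assms(2,1)] assms(3)
    by (blast intro: smooth_on_has_derivative has_derivative_linear)
  have "differential M (\<lambda>q. \<phi> q \<bullet> b) p v = differential M \<phi> p v \<bullet> b" for b
    using differential_bounded_linear[OF bounded_linear_inner_left smooth_fun_chart[OF assms(1)]] assms(3)
    by blast
  thus "differential M f p v = (\<Sum>b\<in>Basis. frechet_derivative (f \<circ> inv_into D \<phi>) (at (\<phi> p)) b *\<^sub>R
      differential M (\<lambda>q. \<phi> q \<bullet> b) p) v"
    using linear_basis_expansion[OF lin, of "differential M \<phi> p v"]
    by (simp add: differential_in_chart[OF assms] blinfun.sum_left blinfun.scaleR_left mult.commute)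
qed

lemma smooth_fun_vector_field:
  fixes f :: "'m \<Rightarrow> real"
  assumes "smooth_vector_field M W X" "smooth_fun M W f"
  shows "smooth_fun M W (\<lambda>p. differential M f p (X p))"
proof (rule smooth_fun_local)
  fix p
  assume p: "p \<in> W"
  obtain D \<phi> where c: "chart_at M p = (D, \<phi>)" by (cases "chart_at M p")
  have "p \<in> topspace (mtop M)" using assms(2) p smooth_fun_topspace by blast
  note c' = chart_at_atlas[OF this c]
  have X: "smooth_fun M (D \<inter> W) (\<lambda>q. differential M \<phi> q (X q))"
    using assms(1) c'(1) by (auto simp: smooth_vector_field_def)
  have eq: "differential M f q (X q) = (\<Sum>b\<in>Basis. (differential M \<phi> q (X q) \<bullet> b) *
      frechet_derivative (f \<circ> inv_into D \<phi>) (at (\<phi> q)) b)" if "q \<in> D \<inter> W" for q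
  proof -
    have lin: "linear (frechet_derivative (f \<circ> inv_into D \<phi>) (at (\<phi> q)))"
      using smooth_fun_in_chart[OF assms(2) c'(1)] that
      by (blast intro: smooth_on_has_derivative has_derivative_linear)
    show ?thesis
      using linear_basis_expansion[OF lin, of "differential M \<phi> q (X q)"]
      by (simp add: differential_in_chart[OF c'(1) assms(2) that])
  qed
  have "smooth_fun M (D \<inter> W) (\<lambda>q. \<Sum>b\<in>Basis. (differential M \<phi> q (X q) \<bullet> b) *
      frechet_derivative (f \<circ> inv_into D \<phi>) (at (\<phi> q)) b)"
    by (intro smooth_fun_sum smooth_fun_mult smooth_fun_inner_left X
        smooth_fun_frechet_derivative_in_chart c'(1) assms(2) smooth_fun_openin[OF X])
  hence "smooth_fun M (D \<inter> W) (\<lambda>q. differential M f q (X q))"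
    by (rule smooth_fun_cong) (simp add: eq)
  thus "\<exists>W'. p \<in> W' \<and> W' \<subseteq> W \<and> smooth_fun M W' (\<lambda>q. differential M f q (X q))"
    using p c'(2) by blast
qed

section \<open>Cut-off functions\<close>

text \<open>
  The support \<open>K\<close> is closed in \<open>M\<close> and not merely in \<open>W\<close>; this is what makes extension by zero smooth.
\<close>

lemma smooth_bump:
  assumes "openin (mtop M) W" "p \<in> W"
  obtains \<kappa> :: "'m \<Rightarrow> real" and K where "smooth_fun M (topspace (mtop M)) \<kappa>" "\<kappa> p = 1"
    "closedin (mtop M) K" "K \<subseteq> W" "\<forall>q. q \<notin> K \<longrightarrow> \<kappa> q = 0"
proof -
  obtain D \<phi> where c: "chart_at M p = (D, \<phi>)" by (cases "chart_at M p")
  have "p \<in> topspace (mtop M)" using assms openin_subset by blast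
  note c' = chart_at_atlas[OF this c]
  have o: "open (\<phi> ` (D \<inter> W))" using chart_open_image[OF c'(1) assms(1)] .
  have "\<phi> p \<in> \<phi> ` (D \<inter> W)" using c'(2) assms(2) by blast
  with o obtain r where r: "r > 0" "cball (\<phi> p) r \<subseteq> \<phi> ` (D \<inter> W)" using open_contains_cball by blast
  obtain \<beta> :: "'e \<Rightarrow> real" where \<beta>: "smooth_on UNIV \<beta>" "\<beta> (\<phi> p) = 1" "\<And>z. z \<notin> cball (\<phi> p) r \<Longrightarrow> \<beta> z = 0"
    using smooth_bump_euclidean[OF r(1)] by blast
  define K where "K = {q \<in> D. \<phi> q \<in> cball (\<phi> p) r}"
  define \<kappa> where "\<kappa> = (\<lambda>q. if q \<in> D then \<beta> (\<phi> q) else 0)"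
  have K: "K \<subseteq> D \<inter> W"
  proof
    fix q assume "q \<in> K"
    then obtain q' where "q \<in> D" "q' \<in> D \<inter> W" "\<phi> q = \<phi> q'" using r(2) unfolding K_def by blast
    thus "q \<in> D \<inter> W" using chart_inj[OF c'(1)] by (auto dest: inj_onD)
  qed
  \<comment> \<open>The closed ball is compact in the chart, hence in the manifold; this is where the
    Hausdorff property enters.\<close>
  have "K = inv_into D \<phi> ` cball (\<phi> p) r"
  proof (intro equalityI subsetI)
    fix q assume "q \<in> K"
    thus "q \<in> inv_into D \<phi> ` cball (\<phi> p) r"
      unfolding K_def using chart_inverse[OF c'(1)] by (auto intro!: rev_image_eqI[of "\<phi> q"])
  next
    fix q assume "q \<in> inv_into D \<phi> ` cball (\<phi> p) r"
    then obtain y where y: "y \<in> cball (\<phi> p) r" "q = inv_into D \<phi> y" by blast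
    then obtain q' where "q' \<in> D" "y = \<phi> q'" using r(2) by blast
    thus "q \<in> K" using y chart_inverse[OF c'(1)] by (auto simp: K_def)
  qed
  moreover have "continuous_map (top_of_set (\<phi> ` D)) (mtop M) (inv_into D \<phi>)"
  proof -
    obtain g where g: "homeomorphic_maps (subtopology (mtop M) D) (top_of_set (\<phi> ` D)) \<phi> g"
      using chart_homeomorphic[OF c'(1)] homeomorphic_map_maps by blast
    have "topspace (subtopology (mtop M) D) = D"
      using openin_subset[OF chart_openin[OF c'(1)]] by auto
    hence "g y = inv_into D \<phi> y" if "y \<in> \<phi> ` D" for y
      using g that chart_inverse[OF c'(1)] by (auto simp: homeomorphic_maps_def)
    moreover have "continuous_map (top_of_set (\<phi> ` D)) (mtop M) g"
      using g by (auto simp: homeomorphic_maps_def continuous_map_in_subtopology)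
    ultimately show ?thesis by (auto intro: continuous_map_eq)
  qed
  moreover have "compactin (top_of_set (\<phi> ` D)) (cball (\<phi> p) r)"
    using r(2) by (auto simp: compactin_subtopology)
  ultimately have "compactin (mtop M) K"
    using image_compactin by metis
  moreover have "Hausdorff_space (mtop M)" using M by (simp add: smooth_manifold_def)
  ultimately have closed: "closedin (mtop M) K" by (rule compactin_imp_closedin[rotated])
  have zero: "\<forall>q. q \<notin> K \<longrightarrow> \<kappa> q = 0"
    using \<beta>(3) by (auto simp: \<kappa>_def K_def)
  have "smooth_fun M D (\<lambda>q. \<beta> (\<phi> q))"
    by (rule smooth_fun_compose[OF smooth_fun_chart[OF c'(1)] open_UNIV _ \<beta>(1)]) auto
  hence D: "smooth_fun M D \<kappa>" by (rule smooth_fun_cong) (simp add: \<kappa>_def)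
  have "smooth_fun M (topspace (mtop M) - K) (\<lambda>q. 0 :: real)"
    using closed by (intro smooth_fun_const) auto
  hence nK: "smooth_fun M (topspace (mtop M) - K) \<kappa>" by (rule smooth_fun_cong) (simp add: zero)
  have "smooth_fun M (topspace (mtop M)) \<kappa>"
  proof (rule smooth_fun_local)
    fix q assume "q \<in> topspace (mtop M)"
    with D have "q \<in> D \<and> D \<subseteq> topspace (mtop M) \<and> smooth_fun M D \<kappa> \<or>
        q \<in> topspace (mtop M) - K \<and> smooth_fun M (topspace (mtop M) - K) \<kappa>"
      using nK K openin_subset[OF chart_openin[OF c'(1)]] by blast
    thus "\<exists>W'. q \<in> W' \<and> W' \<subseteq> topspace (mtop M) \<and> smooth_fun M W' \<kappa>" by (metis Diff_subset)
  qed
  moreover have "\<kappa> p = 1" using c'(2) \<beta>(2) by (simp add: \<kappa>_def)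
  moreover have "K \<subseteq> W" using K by blast
  ultimately show thesis by (rule that[OF _ _ closed _ zero])
qed

text \<open>
  The open sets \<open>W \<inter> V\<close>, where the function is a product, and \<open>W - K\<close>, where it is zero, cover \<open>W\<close>.
\<close>

lemma smooth_fun_cutoff:
  fixes \<kappa> h :: "'m \<Rightarrow> real"
  assumes "smooth_fun M (topspace (mtop M)) \<kappa>" "closedin (mtop M) K" "K \<subseteq> V"
    and "\<forall>q. q \<notin> K \<longrightarrow> \<kappa> q = 0" and "openin (mtop M) W" "smooth_fun M (W \<inter> V) h"
  shows "smooth_fun M W (\<lambda>q. if q \<in> V then \<kappa> q * h q else 0)"
proof (rule smooth_fun_local)
  fix q
  assume q: "q \<in> W"
  have oV: "openin (mtop M) (W \<inter> V)" using assms(6) smooth_fun_openin by blast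
  have oK: "openin (mtop M) (W - K)" using assms(2,5) by (simp add: openin_diff)
  show "\<exists>W'. q \<in> W' \<and> W' \<subseteq> W \<and> smooth_fun M W' (\<lambda>q. if q \<in> V then \<kappa> q * h q else 0)"
  proof (cases "q \<in> V")
    case True
    have "smooth_fun M (W \<inter> V) (\<lambda>q. \<kappa> q * h q)"
      using smooth_fun_subset[OF assms(1) oV openin_subset[OF oV]] assms(6) by (rule smooth_fun_mult)
    hence "smooth_fun M (W \<inter> V) (\<lambda>q. if q \<in> V then \<kappa> q * h q else 0)"
      by (rule smooth_fun_cong) simp
    thus ?thesis using True q by blast
  next
    case False
    have "smooth_fun M (W - K) (\<lambda>q. if q \<in> V then \<kappa> q * h q else 0)"
      by (rule smooth_fun_cong[OF smooth_fun_const[OF oK, of 0]]) (simp add: assms(4))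
    thus ?thesis using False q assms(3) by blast
  qed
qed

text \<open>
  The affine function in the chart with linear part \<open>\<xi>\<close> and a zero at \<open>p\<close>, cut off. Since it vanishes
  at \<open>p\<close>, the derivative of the cut-off function does not contribute.
\<close>

lemma exists_smooth_function_with_differential:
  assumes "p \<in> topspace (mtop M)"
  obtains f where "f \<in> smooth_functions M" "differential M f p = \<xi>"
proof -
  obtain D \<phi> where c: "chart_at M p = (D, \<phi>)" by (cases "chart_at M p")
  note c' = chart_at_atlas[OF assms c]
  note D = chart_openin[OF c'(1)]
  obtain \<kappa> :: "'m \<Rightarrow> real" and K where \<kappa>: "smooth_fun M (topspace (mtop M)) \<kappa>" "\<kappa> p = 1"
    "closedin (mtop M) K" "K \<subseteq> D" "\<forall>q. q \<notin> K \<longrightarrow> \<kappa> q = 0"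
    by (rule smooth_bump[OF D c'(2)])
  define h where "h = (\<lambda>q. blinfun_apply \<xi> (\<phi> q) + (- blinfun_apply \<xi> (\<phi> p)))"
  have h: "smooth_fun M D h"
    unfolding h_def
    by (intro smooth_fun_add smooth_fun_const D smooth_fun_bounded_linear[OF blinfun.bounded_linear_right]
        smooth_fun_chart[OF c'(1)])
  define f where "f = (\<lambda>q. if q \<in> D then \<kappa> q * h q else 0)"
  have "smooth_fun M (topspace (mtop M)) f"
    unfolding f_def
    by (rule smooth_fun_cutoff[OF \<kappa>(1,3-5)])
      (use openin_subset[OF D] h in \<open>auto simp: Int_absorb1\<close>)
  moreover have "differential M f p = \<xi>"
  proof -
    have "differential M f p = differential M (\<lambda>q. \<kappa> q * h q) p"
      by (rule differential_cong[OF D c'(2)]) (simp add: f_def)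
    also have "\<dots> = differential M h p"
      using differential_mult[OF smooth_fun_subset[OF \<kappa>(1) D openin_subset[OF D]] h c'(2)] \<kappa>(2)
      by (simp add: h_def)
    also have "\<dots> = \<xi>"
    proof -
      have "((\<lambda>y. blinfun_apply \<xi> y + (- blinfun_apply \<xi> (\<phi> p))) has_derivative blinfun_apply \<xi>) (at (\<phi> p))"
        by (auto intro!: derivative_eq_intros)
      hence "((h \<circ> inv_into D \<phi>) has_derivative blinfun_apply \<xi>) (at (\<phi> p))"
        by (rule has_derivative_transform_within_open[OF _ chart_open_UNIV[OF c'(1)]])
          (use c'(2) chart_inverse[OF c'(1)] in \<open>auto simp: h_def\<close>)
      from differential_eqI[OF c this] show ?thesis by (intro blinfun_eqI) simp
    qed
    finally show ?thesis .
  qed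
  ultimately show thesis using that by blast
qed

end

section \<open>The isotropy Lie algebra\<close>

context smooth_mfd
begin

lemma poisson_bracket_in_chart:
  assumes "smooth_bivector_field M \<pi>" "(D, \<phi>) \<in> atlas M" "p \<in> D"
    and "f \<in> smooth_functions M" "g \<in> smooth_functions M"
  shows "poisson_bracket M \<pi> f g p = (\<Sum>b\<in>Basis. \<Sum>c\<in>Basis.
    (frechet_derivative (f \<circ> inv_into D \<phi>) (at (\<phi> p)) b *
     frechet_derivative (g \<circ> inv_into D \<phi>) (at (\<phi> p)) c) *
    \<pi> p (differential M (\<lambda>q. \<phi> q \<bullet> b) p) (differential M (\<lambda>q. \<phi> q \<bullet> c) p))"
proof -
  have p: "p \<in> topspace (mtop M)" using assms(3) openin_subset[OF chart_openin[OF assms(2)]] by blast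
  hence bil: "bilinear (\<pi> p)" using assms(1) by (simp add: smooth_bivector_field_def)
  have f: "smooth_fun M (topspace (mtop M)) f" and g: "smooth_fun M (topspace (mtop M)) g"
    using assms(4,5) by auto
  show ?thesis
    unfolding poisson_bracket_def
    using differential_expansion[OF assms(2) f, of p] differential_expansion[OF assms(2) g, of p] assms(3) p
    by (simp add: bilinear_sum[OF bil] sum.cartesian_product bilinear_lmul[OF bil] bilinear_rmul[OF bil]
        ac_simps)
qed

text \<open>
  This makes the isotropy bracket well defined: the right-hand side depends on \<open>f\<close> and \<open>g\<close> only through
  their differentials at \<open>x\<close>.
\<close>

lemma differential_poisson_bracket:
  assumes "smooth_bivector_field M \<pi>" "isotropy_point M \<pi> x"
  shows "\<exists>\<Lambda>. \<forall>f\<in>smooth_functions M. \<forall>g\<in>smooth_functions M.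
    differential M (poisson_bracket M \<pi> f g) x =
      (\<Sum>b\<in>Basis. \<Sum>c\<in>Basis. (differential M f x b * differential M g x c) *\<^sub>R \<Lambda> b c)"
proof -
  obtain D \<phi> where c: "chart_at M x = (D, \<phi>)" by (cases "chart_at M x")
  have x: "x \<in> topspace (mtop M)" and zero: "\<And>\<xi> \<eta>. \<pi> x \<xi> \<eta> = 0"
    using assms(2) by (auto simp: isotropy_point_def)
  note c' = chart_at_atlas[OF x c]
  note D = chart_openin[OF c'(1)]
  define P where "P = (\<lambda>b c p. \<pi> p (differential M (\<lambda>q. \<phi> q \<bullet> b) p) (differential M (\<lambda>q. \<phi> q \<bullet> c) p))"
  have P: "smooth_fun M D (P b c)" if "b \<in> Basis" "c \<in> Basis" for b c
    using assms(1) c'(1) that unfolding smooth_bivector_field_def P_def by blast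
  have "differential M (poisson_bracket M \<pi> f g) x =
      (\<Sum>b\<in>Basis. \<Sum>c\<in>Basis. (differential M f x b * differential M g x c) *\<^sub>R differential M (P b c) x)"
    if fg: "f \<in> smooth_functions M" "g \<in> smooth_functions M" for f g
  proof -
    define d where "d = (\<lambda>(h :: 'm \<Rightarrow> real) b p. frechet_derivative (h \<circ> inv_into D \<phi>) (at (\<phi> p)) b)"
    have d: "smooth_fun M D (d h b)" if "h \<in> smooth_functions M" for h b
      unfolding d_def using smooth_fun_frechet_derivative_in_chart[OF c'(1), of "topspace (mtop M)" h b] that
        openin_subset[OF D] by (simp add: Int_absorb2)
    have dx: "d h b x = differential M h x b" if "h \<in> smooth_functions M" for h b
      using differential_has_derivative[OF _ x c, of h] that frechet_derivative_at
      unfolding d_def by (metis mem_Collect_eq)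
    have s: "smooth_fun M D (\<lambda>p. (d f b p * d g c p) * P b c p)" if "b \<in> Basis" "c \<in> Basis" for b c
      by (intro smooth_fun_mult d P fg that)
    have "differential M (poisson_bracket M \<pi> f g) x =
        differential M (\<lambda>p. \<Sum>b\<in>Basis. \<Sum>c\<in>Basis. (d f b p * d g c p) * P b c p) x"
      by (rule differential_cong[OF D c'(2)])
        (simp add: poisson_bracket_in_chart[OF assms(1) c'(1) _ fg] P_def d_def)
    also have "\<dots> = (\<Sum>b\<in>Basis. \<Sum>c\<in>Basis. differential M (\<lambda>p. (d f b p * d g c p) * P b c p) x)"
      by (simp add: differential_sum[OF D c'(2)] smooth_fun_sum[OF D] s)
    \<comment> \<open>At \<open>x\<close> the coefficients \<open>P b c\<close> vanish, so only their derivatives survive.\<close>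
    also have "\<dots> = (\<Sum>b\<in>Basis. \<Sum>c\<in>Basis. (d f b x * d g c x) *\<^sub>R differential M (P b c) x)"
    proof (intro sum.cong refl)
      fix b c :: 'e
      assume "b \<in> Basis" "c \<in> Basis"
      from differential_mult[OF smooth_fun_mult[OF d[OF fg(1), of b] d[OF fg(2), of c]] P[OF this] c'(2)]
      show "differential M (\<lambda>p. (d f b p * d g c p) * P b c p) x =
          (d f b x * d g c x) *\<^sub>R differential M (P b c) x"
        by (simp add: P_def zero)
    qed
    finally show ?thesis by (simp only: dx[OF fg(1)] dx[OF fg(2)])
  qed
  thus ?thesis by (intro exI[of _ "\<lambda>b c. differential M (P b c) x"] ballI)
qed

lemma isotropy_bracket_eq:
  assumes "smooth_bivector_field M \<pi>" "isotropy_point M \<pi> x"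
    and "f \<in> smooth_functions M" "g \<in> smooth_functions M"
  shows "isotropy_bracket M \<pi> x (differential M f x) (differential M g x) =
    differential M (poisson_bracket M \<pi> f g) x"
proof -
  from differential_poisson_bracket[OF assms(1,2)] obtain \<Lambda>
    where \<Lambda>: "\<forall>f\<in>smooth_functions M. \<forall>g\<in>smooth_functions M.
      differential M (poisson_bracket M \<pi> f g) x =
        (\<Sum>b\<in>Basis. \<Sum>c\<in>Basis. (differential M f x b * differential M g x c) *\<^sub>R \<Lambda> b c)" ..
  show ?thesis
    unfolding isotropy_bracket_def
  proof (rule the_equality)
    show "\<exists>f'\<in>smooth_functions M. \<exists>g'\<in>smooth_functions M.
        differential M f' x = differential M f x \<and> differential M g' x = differential M g x \<and>
        differential M (poisson_bracket M \<pi> f g) x = differential M (poisson_bracket M \<pi> f' g') x"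
      using assms(3,4) by blast
    fix \<zeta>
    assume "\<exists>f'\<in>smooth_functions M. \<exists>g'\<in>smooth_functions M.
        differential M f' x = differential M f x \<and> differential M g' x = differential M g x \<and>
        \<zeta> = differential M (poisson_bracket M \<pi> f' g') x"
    then obtain f' g' where "f' \<in> smooth_functions M" "g' \<in> smooth_functions M"
      "differential M f' x = differential M f x" "differential M g' x = differential M g x"
      "\<zeta> = differential M (poisson_bracket M \<pi> f' g') x" by blast
    thus "\<zeta> = differential M (poisson_bracket M \<pi> f g) x"
      by (simp only: \<Lambda>[rule_format, OF assms(3,4)] \<Lambda>[rule_format, of f' g'])
  qed
qed

end

section \<open>Lie algebroids\<close>

locale mfd_lie_algebroid = smooth_mfd M for M :: "('m, 'e::euclidean_space) mfd" +
  fixes A :: "('m, 'v::real_vector, 'e) lie_algebroid"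
  assumes A: "is_lie_algebroid M A"
begin

text \<open>
  The function usually written \<open>\<rho>(s) f\<close>.
\<close>

abbreviation anchored_derivative :: "('m \<Rightarrow> 'v) \<Rightarrow> ('m \<Rightarrow> real) \<Rightarrow> 'm \<Rightarrow> real" where
  "anchored_derivative s f \<equiv> \<lambda>p. blinfun_apply (differential M f p) (la_anchor A p (s p))"

lemma vbundle: "smooth_vbundle M A" and anchor: "smooth_anchor M A"
  using A by (auto simp: is_lie_algebroid_def)

lemma base_openin: "openin (mtop M) (vb_base A)"
  using vbundle by (simp add: smooth_vbundle_def)

lemma fibre_subspace: "p \<in> vb_base A \<Longrightarrow> subspace (vb_fibre A p)"
  using vbundle by (simp add: smooth_vbundle_def)

lemma frame_exists:
  assumes "p \<in> vb_base A"
  obtains V e where "(V, e) \<in> vb_frames A" "p \<in> V"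
proof -
  have "p \<in> (\<Union>(V, e)\<in>vb_frames A. V)" using assms vbundle unfolding smooth_vbundle_def by metis
  thus thesis using that by auto
qed

lemma frame_subset_base: "(V, e) \<in> vb_frames A \<Longrightarrow> V \<subseteq> vb_base A"
proof -
  assume "(V, e) \<in> vb_frames A"
  hence "V \<subseteq> (\<Union>(V, e)\<in>vb_frames A. V)" by auto
  also have "\<dots> = vb_base A" using vbundle unfolding smooth_vbundle_def by metis
  finally show ?thesis .
qed

lemma frameD:
  assumes "(V, e) \<in> vb_frames A"
  shows frame_openin: "openin (mtop M) V"
    and frame_inj: "p \<in> V \<Longrightarrow> inj_on (\<lambda>i. e i p) {..<vb_rank A}"
    and frame_independent: "p \<in> V \<Longrightarrow> independent ((\<lambda>i. e i p) ` {..<vb_rank A})"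
    and frame_span: "p \<in> V \<Longrightarrow> span ((\<lambda>i. e i p) ` {..<vb_rank A}) = vb_fibre A p"
proof -
  have *: "\<forall>(V, e)\<in>vb_frames A. openin (mtop M) V \<and>
      (\<forall>p\<in>V. inj_on (\<lambda>i. e i p) {..<vb_rank A} \<and>
        independent ((\<lambda>i. e i p) ` {..<vb_rank A}) \<and>
        span ((\<lambda>i. e i p) ` {..<vb_rank A}) = vb_fibre A p)"
    using vbundle by (simp add: smooth_vbundle_def)
  note ** = bspec[OF * assms, unfolded prod.case]
  show "openin (mtop M) V"
    and "p \<in> V \<Longrightarrow> inj_on (\<lambda>i. e i p) {..<vb_rank A}"
    and "p \<in> V \<Longrightarrow> independent ((\<lambda>i. e i p) ` {..<vb_rank A})"
    and "p \<in> V \<Longrightarrow> span ((\<lambda>i. e i p) ` {..<vb_rank A}) = vb_fibre A p"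
    using ** by simp_all
qed

lemma frame_in_fibre:
  "(V, e) \<in> vb_frames A \<Longrightarrow> p \<in> V \<Longrightarrow> i < vb_rank A \<Longrightarrow> e i p \<in> vb_fibre A p"
  using frame_span[of V e p] span_base[of "e i p" "(\<lambda>i. e i p) ` {..<vb_rank A}"] by blast

lemma frame_coordinates:
  assumes "(V, e) \<in> vb_frames A" "p \<in> V" "v \<in> vb_fibre A p"
  obtains c where "v = (\<Sum>i<vb_rank A. c i *\<^sub>R e i p)"
proof -
  have "v \<in> span ((\<lambda>i. e i p) ` {..<vb_rank A})" using assms frame_span by blast
  then obtain u where "v = (\<Sum>w\<in>(\<lambda>i. e i p) ` {..<vb_rank A}. u w *\<^sub>R w)"
    by (auto simp: span_finite)
  hence "v = (\<Sum>i<vb_rank A. u (e i p) *\<^sub>R e i p)"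
    by (simp add: sum.reindex[OF frame_inj[OF assms(1,2)]])
  thus thesis by (rule that)
qed

lemma frame_change_smooth:
  assumes "(V, e) \<in> vb_frames A" "(V', e') \<in> vb_frames A" "j < vb_rank A"
  shows "smooth_in_frame M (vb_rank A) (V \<inter> V') e (e' j)"
proof -
  have *: "\<forall>(V, e)\<in>vb_frames A. \<forall>(V', e')\<in>vb_frames A. \<forall>j<vb_rank A.
      smooth_in_frame M (vb_rank A) (V \<inter> V') e (e' j)"
    using vbundle by (simp add: smooth_vbundle_def)
  show ?thesis
    using bspec[OF bspec[OF * assms(1), unfolded prod.case] assms(2), unfolded prod.case] assms(3) by blast
qed

lemma anchor_sum:
  assumes "p \<in> vb_base A" "\<And>i. i \<in> I \<Longrightarrow> v i \<in> vb_fibre A p"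
  shows "la_anchor A p (\<Sum>i\<in>I. c i *\<^sub>R v i) = (\<Sum>i\<in>I. c i *\<^sub>R la_anchor A p (v i))"
proof -
  have lin: "la_anchor A p (a *\<^sub>R u + b *\<^sub>R v) = a *\<^sub>R la_anchor A p u + b *\<^sub>R la_anchor A p v"
    if "u \<in> vb_fibre A p" "v \<in> vb_fibre A p" for u v a b
    using anchor assms(1) that by (simp add: smooth_anchor_def)
  note sub = fibre_subspace[OF assms(1)]
  have zero: "la_anchor A p 0 = 0" using lin[of 0 0 0 0] subspace_0[OF sub] by simp
  show ?thesis
    using assms(2)
  proof (induction I rule: infinite_finite_induct)
    case (insert i I)
    have "la_anchor A p (c i *\<^sub>R v i + 1 *\<^sub>R (\<Sum>i\<in>I. c i *\<^sub>R v i)) =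
        c i *\<^sub>R la_anchor A p (v i) + 1 *\<^sub>R la_anchor A p (\<Sum>i\<in>I. c i *\<^sub>R v i)"
      by (intro lin subspace_sum[OF sub] subspace_scale[OF sub]) (use insert.prems in auto)
    thus ?case using insert by simp
  qed (simp_all add: zero)
qed

lemma anchor_frame_smooth:
  assumes "(V, e) \<in> vb_frames A" "i < vb_rank A"
  shows "smooth_vector_field M V (\<lambda>p. la_anchor A p (e i p))"
proof -
  have *: "\<forall>(V, e)\<in>vb_frames A. \<forall>i<vb_rank A. smooth_vector_field M V (\<lambda>p. la_anchor A p (e i p))"
    using anchor by (simp add: smooth_anchor_def)
  show ?thesis using bspec[OF * assms(1), unfolded prod.case] assms(2) by blast
qed

lemma section_in_fibre: "s \<in> vb_sections M A \<Longrightarrow> p \<in> vb_base A \<Longrightarrow> s p \<in> vb_fibre A p"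
  and section_outside: "s \<in> vb_sections M A \<Longrightarrow> p \<notin> vb_base A \<Longrightarrow> s p = 0"
  by (simp_all add: vb_sections_def)

lemma section_in_frame:
  assumes "s \<in> vb_sections M A" "(V, e) \<in> vb_frames A"
  obtains c where "\<And>i. i < vb_rank A \<Longrightarrow> smooth_fun M V (c i)"
    "\<And>p. p \<in> V \<Longrightarrow> s p = (\<Sum>i<vb_rank A. c i p *\<^sub>R e i p)"
proof -
  have *: "\<forall>(V, e)\<in>vb_frames A. smooth_in_frame M (vb_rank A) V e s"
    using assms(1) by (simp add: vb_sections_def)
  show thesis using bspec[OF * assms(2), unfolded prod.case] that unfolding smooth_in_frame_def by blast
qed

lemma smooth_anchored_derivative:
  assumes "s \<in> vb_sections M A" "smooth_fun M (vb_base A) f"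
  shows "smooth_fun M (vb_base A) (anchored_derivative s f)"
proof (rule smooth_fun_local)
  fix p
  assume p: "p \<in> vb_base A"
  obtain V e where Ve: "(V, e) \<in> vb_frames A" "p \<in> V" using frame_exists[OF p] .
  obtain c where c: "\<And>i. i < vb_rank A \<Longrightarrow> smooth_fun M V (c i)"
    "\<And>p. p \<in> V \<Longrightarrow> s p = (\<Sum>i<vb_rank A. c i p *\<^sub>R e i p)"
    using section_in_frame[OF assms(1) Ve(1)] by blast
  note V = frame_openin[OF Ve(1)] frame_subset_base[OF Ve(1)]
  have "smooth_fun M V (\<lambda>q. \<Sum>i<vb_rank A. c i q * differential M f q (la_anchor A q (e i q)))"
    by (intro smooth_fun_sum V(1) smooth_fun_mult c(1)
        smooth_fun_vector_field[OF anchor_frame_smooth[OF Ve(1)] smooth_fun_subset[OF assms(2) V]]) auto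
  hence "smooth_fun M V (anchored_derivative s f)"
  proof (rule smooth_fun_cong)
    fix q assume q: "q \<in> V"
    hence "la_anchor A q (s q) = (\<Sum>i<vb_rank A. c i q *\<^sub>R la_anchor A q (e i q))"
      unfolding c(2)[OF q] using V(2) frame_in_fibre[OF Ve(1)] by (intro anchor_sum) auto
    thus "(\<Sum>i<vb_rank A. c i q * differential M f q (la_anchor A q (e i q))) = anchored_derivative s f q"
      by (simp add: blinfun.sum_right blinfun.scaleR_right)
  qed
  thus "\<exists>W'. p \<in> W' \<and> W' \<subseteq> vb_base A \<and> smooth_fun M W' (anchored_derivative s f)"
    using V(2) Ve(2) by blast
qed

lemma section_add:
  assumes "s \<in> vb_sections M A" "t \<in> vb_sections M A"
  shows "(\<lambda>p. s p + t p) \<in> vb_sections M A"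
  unfolding vb_sections_def mem_Collect_eq
proof (intro conjI ballI allI impI, goal_cases)
  case (1 p)
  thus ?case using assms by (intro subspace_add fibre_subspace section_in_fibre)
next
  case (2 p)
  thus ?case using assms by (simp add: section_outside)
next
  case (3 Ve)
  obtain V e where Ve: "Ve = (V, e)" by (cases Ve)
  obtain c where c: "\<And>i. i < vb_rank A \<Longrightarrow> smooth_fun M V (c i)"
    "\<And>p. p \<in> V \<Longrightarrow> s p = (\<Sum>i<vb_rank A. c i p *\<^sub>R e i p)"
    using section_in_frame[OF assms(1) 3[unfolded Ve]] by blast
  obtain d where d: "\<And>i. i < vb_rank A \<Longrightarrow> smooth_fun M V (d i)"
    "\<And>p. p \<in> V \<Longrightarrow> t p = (\<Sum>i<vb_rank A. d i p *\<^sub>R e i p)"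
    using section_in_frame[OF assms(2) 3[unfolded Ve]] by blast
  show ?case
    unfolding Ve prod.case smooth_in_frame_def
    by (rule exI[of _ "\<lambda>i p. c i p + d i p"])
      (simp add: c d smooth_fun_add scaleR_add_left sum.distrib)
qed

lemma section_scale:
  assumes "smooth_fun M (vb_base A) f" "s \<in> vb_sections M A"
  shows "(\<lambda>p. f p *\<^sub>R s p) \<in> vb_sections M A"
  unfolding vb_sections_def mem_Collect_eq
proof (intro conjI ballI allI impI, goal_cases)
  case (1 p)
  thus ?case using assms by (intro subspace_scale fibre_subspace section_in_fibre)
next
  case (2 p)
  thus ?case using assms by (simp add: section_outside)
next
  case (3 Ve)
  obtain V e where Ve: "Ve = (V, e)" by (cases Ve)
  obtain c where c: "\<And>i. i < vb_rank A \<Longrightarrow> smooth_fun M V (c i)"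
    "\<And>p. p \<in> V \<Longrightarrow> s p = (\<Sum>i<vb_rank A. c i p *\<^sub>R e i p)"
    using section_in_frame[OF assms(2) 3[unfolded Ve]] by blast
  have "smooth_fun M V f"
    using assms(1) frame_openin[OF 3[unfolded Ve]] frame_subset_base[OF 3[unfolded Ve]]
    by (rule smooth_fun_subset)
  thus ?case
    unfolding Ve prod.case smooth_in_frame_def
    by (intro exI[of _ "\<lambda>i p. f p * c i p"]) (simp add: c smooth_fun_mult scaleR_sum_right)
qed

text \<open>
  The bracket of a Lie algebroid acts on sections over the whole base. Cutting off makes a local
  combination of frame elements into such a section.
\<close>

lemma section_cutoff:
  fixes \<kappa> :: "'m \<Rightarrow> real"
  assumes Ve: "(V, e) \<in> vb_frames A"
    and \<kappa>: "smooth_fun M (topspace (mtop M)) \<kappa>" "closedin (mtop M) K" "K \<subseteq> V"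
      "\<forall>q. q \<notin> K \<longrightarrow> \<kappa> q = 0"
    and h: "\<And>i. i < vb_rank A \<Longrightarrow> smooth_fun M V (h i)"
  shows "(\<lambda>p. if p \<in> V then \<kappa> p *\<^sub>R (\<Sum>i<vb_rank A. h i p *\<^sub>R e i p) else 0) \<in> vb_sections M A"
    (is "?s \<in> _")
  unfolding vb_sections_def mem_Collect_eq
proof (intro conjI ballI allI impI, goal_cases)
  case (1 p)
  note sub = fibre_subspace[OF this]
  show ?case
    by (auto intro!: subspace_0[OF sub] subspace_scale[OF sub] subspace_sum[OF sub] frame_in_fibre[OF Ve])
next
  case (2 p)
  thus ?case using frame_subset_base[OF Ve] by auto
next
  case (3 Ve')
  obtain V' e' where Ve': "Ve' = (V', e')" by (cases Ve')
  note V' = 3[unfolded Ve']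
  have "\<forall>j. \<exists>c. j < vb_rank A \<longrightarrow> (\<forall>i<vb_rank A. smooth_fun M (V' \<inter> V) (c i)) \<and>
      (\<forall>p\<in>V' \<inter> V. e j p = (\<Sum>i<vb_rank A. c i p *\<^sub>R e' i p))"
    using frame_change_smooth[OF V' Ve] unfolding smooth_in_frame_def by blast
  then obtain c where c: "\<And>i j. i < vb_rank A \<Longrightarrow> j < vb_rank A \<Longrightarrow> smooth_fun M (V' \<inter> V) (c j i)"
      "\<And>j p. j < vb_rank A \<Longrightarrow> p \<in> V' \<inter> V \<Longrightarrow> e j p = (\<Sum>i<vb_rank A. c j i p *\<^sub>R e' i p)"
    by metis
  have oV: "openin (mtop M) (V' \<inter> V)" using frame_openin[OF Ve] frame_openin[OF V'] by blast
  define H where "H = (\<lambda>i p. \<Sum>j<vb_rank A. h j p * c j i p)"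
  have H: "smooth_fun M (V' \<inter> V) (H i)" if "i < vb_rank A" for i
    unfolding H_def
    by (intro smooth_fun_sum oV smooth_fun_mult smooth_fun_subset[OF h oV] c(1)) (use that in auto)
  show ?case
    unfolding Ve' prod.case smooth_in_frame_def
  proof (intro exI[of _ "\<lambda>i p. if p \<in> V then \<kappa> p * H i p else 0"] conjI allI impI ballI)
    show "smooth_fun M V' (\<lambda>p. if p \<in> V then \<kappa> p * H i p else 0)" if "i < vb_rank A" for i
      by (rule smooth_fun_cutoff[OF \<kappa> frame_openin[OF V'] H[OF that]])
    fix p assume p: "p \<in> V'"
    have "(\<Sum>j<vb_rank A. h j p *\<^sub>R e j p) = (\<Sum>i<vb_rank A. H i p *\<^sub>R e' i p)" if "p \<in> V"
    proof -
      have "(\<Sum>j<vb_rank A. h j p *\<^sub>R e j p) =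
          (\<Sum>j<vb_rank A. \<Sum>i<vb_rank A. (h j p * c j i p) *\<^sub>R e' i p)"
        using c(2) p that by (simp add: scaleR_sum_right)
      also have "\<dots> = (\<Sum>i<vb_rank A. H i p *\<^sub>R e' i p)"
        unfolding H_def by (subst sum.swap) (simp add: scaleR_sum_left)
      finally show ?thesis .
    qed
    thus "?s p = (\<Sum>i<vb_rank A. (if p \<in> V then \<kappa> p * H i p else 0) *\<^sub>R e' i p)"
      by (simp add: scaleR_sum_right)
  qed
qed

context
  fixes br :: "('m \<Rightarrow> 'v) \<Rightarrow> ('m \<Rightarrow> 'v) \<Rightarrow> ('m \<Rightarrow> 'v)"
  defines "br \<equiv> la_bracket A"
begin

lemma bracket_section:
  assumes "s \<in> vb_sections M A" "t \<in> vb_sections M A"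
  shows "br s t \<in> vb_sections M A"
  using A assms by (simp add: is_lie_algebroid_def section_lie_bracket_def br_def Let_def)

lemma bracket_add:
  assumes "s \<in> vb_sections M A" "t \<in> vb_sections M A" "u \<in> vb_sections M A"
  shows "br (\<lambda>p. s p + t p) u p = br s u p + br t u p"
    and "br u (\<lambda>p. s p + t p) p = br u s p + br u t p"
proof -
  have "br (\<lambda>p. a *\<^sub>R s p + b *\<^sub>R t p) u = (\<lambda>p. a *\<^sub>R br s u p + b *\<^sub>R br t u p) \<and>
      br u (\<lambda>p. a *\<^sub>R s p + b *\<^sub>R t p) = (\<lambda>p. a *\<^sub>R br u s p + b *\<^sub>R br u t p)" for a b
    using A assms unfolding is_lie_algebroid_def section_lie_bracket_def br_def Let_def by blast
  from this[of 1 1] show "br (\<lambda>p. s p + t p) u p = br s u p + br t u p"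
    and "br u (\<lambda>p. s p + t p) p = br u s p + br u t p" by simp_all
qed

lemma bracket_self: "s \<in> vb_sections M A \<Longrightarrow> br s s p = 0"
  using A by (simp add: is_lie_algebroid_def section_lie_bracket_def br_def Let_def)

lemma bracket_antisym:
  assumes "s \<in> vb_sections M A" "t \<in> vb_sections M A"
  shows "br t s p = - br s t p"
proof -
  have "0 = br (\<lambda>p. s p + t p) (\<lambda>p. s p + t p) p"
    by (simp add: bracket_self section_add assms)
  also have "\<dots> = br t s p + br s t p"
    by (simp add: bracket_add section_add assms bracket_self)
  finally show ?thesis by (simp add: eq_neg_iff_add_eq_0)
qed

lemma bracket_jacobi:
  assumes "s \<in> vb_sections M A" "t \<in> vb_sections M A" "u \<in> vb_sections M A"
  shows "br s (br t u) p = br t (br s u) p + br (br s t) u p"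
proof -
  have "br s (br t u) p + br t (br u s) p + br u (br s t) p = 0"
    using A assms by (simp add: is_lie_algebroid_def section_lie_bracket_def br_def Let_def)
  moreover have "br t (br u s) p = - br t (br s u) p"
  proof -
    have "br t (br u s) p + br t (br s u) p = br t (\<lambda>q. br u s q + br s u q) p"
      by (simp add: bracket_add bracket_section assms)
    also have "(\<lambda>q. br u s q + br s u q) = br s s"
      using bracket_antisym[OF assms(1,3)] by (auto simp: bracket_self assms)
    also have "br t (br s s) p = 0"
    proof -
      have "br s s = (\<lambda>q. br s s q + br s s q)" using bracket_self[OF assms(1)] by auto
      hence "br t (br s s) p = br t (br s s) p + br t (br s s) p"
        using bracket_add(2)[OF bracket_section bracket_section assms(2), of s s s s p] assms(1) by simp
      thus ?thesis by simp
    qed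
    finally show ?thesis by (simp add: eq_neg_iff_add_eq_0)
  qed
  moreover have "br u (br s t) p = - br (br s t) u p"
    by (intro bracket_antisym bracket_section assms)
  ultimately show ?thesis by (simp add: algebra_simps)
qed

lemma bracket_leibniz:
  assumes "s \<in> vb_sections M A" "t \<in> vb_sections M A" "smooth_fun M (vb_base A) f"
  shows "br s (\<lambda>q. f q *\<^sub>R t q) = (\<lambda>p. f p *\<^sub>R br s t p + anchored_derivative s f p *\<^sub>R t p)"
proof
  fix p
  show "br s (\<lambda>q. f q *\<^sub>R t q) p = f p *\<^sub>R br s t p + anchored_derivative s f p *\<^sub>R t p"
  proof (cases "p \<in> vb_base A")
    case True
    thus ?thesis using A assms by (simp add: is_lie_algebroid_def leibniz_rule_def br_def)
  next
    case False
    have "br s (\<lambda>q. f q *\<^sub>R t q) \<in> vb_sections M A" "br s t \<in> vb_sections M A"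
      by (intro bracket_section section_scale assms)+
    thus ?thesis using False assms(2) by (simp add: section_outside)
  qed
qed

text \<open>
  The anchor maps the bracket of sections to the commutator of derivations. The Jacobi identity for \<open>s\<close>,
  \<open>t\<close>, \<open>f u\<close> is expanded by the Leibniz rule; the mixed terms cancel, the terms with undifferentiated
  \<open>f\<close> form the Jacobi identity for \<open>s\<close>, \<open>t\<close>, \<open>u\<close>, and what is left is the defect of the claim times
  \<open>u p\<close>.
\<close>

lemma anchor_bracket:
  assumes s: "s \<in> vb_sections M A" and t: "t \<in> vb_sections M A"
    and f: "smooth_fun M (vb_base A) f"
    and u: "u \<in> vb_sections M A" "u p \<noteq> 0"
  shows "anchored_derivative (la_bracket A s t) f p =
    anchored_derivative s (anchored_derivative t f) p - anchored_derivative t (anchored_derivative s f) p"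
proof -
  let ?fu = "\<lambda>q. f q *\<^sub>R u q"
  have fu: "?fu \<in> vb_sections M A" by (intro section_scale f u)
  have iter: "br s (br t ?fu) p = f p *\<^sub>R br s (br t u) p + anchored_derivative s f p *\<^sub>R br t u p +
      anchored_derivative t f p *\<^sub>R br s u p + anchored_derivative s (anchored_derivative t f) p *\<^sub>R u p"
    if s: "s \<in> vb_sections M A" and t: "t \<in> vb_sections M A" for s t
  proof -
    note tu = bracket_section[OF t u(1)]
    note tf = smooth_anchored_derivative[OF t f]
    have "br s (br t ?fu) p = br s (\<lambda>q. f q *\<^sub>R br t u q + anchored_derivative t f q *\<^sub>R u q) p"
      by (simp only: bracket_leibniz[OF t u(1) f])
    also have "\<dots> = br s (\<lambda>q. f q *\<^sub>R br t u q) p + br s (\<lambda>q. anchored_derivative t f q *\<^sub>R u q) p"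
      by (intro bracket_add section_scale f tu tf u(1) s)
    finally show ?thesis
      by (simp add: bracket_leibniz[OF s tu f] bracket_leibniz[OF s u(1) tf] add.assoc)
  qed
  have "br s (br t ?fu) p = br t (br s ?fu) p + br (br s t) ?fu p"
    by (intro bracket_jacobi s t fu)
  moreover have "f p *\<^sub>R br s (br t u) p = f p *\<^sub>R br t (br s u) p + f p *\<^sub>R br (br s t) u p"
    by (simp add: bracket_jacobi[OF s t u(1)] scaleR_add_right)
  ultimately have "(anchored_derivative s (anchored_derivative t f) p -
      anchored_derivative t (anchored_derivative s f) p - anchored_derivative (br s t) f p) *\<^sub>R u p = 0"
    unfolding iter[OF s t] iter[OF t s] bracket_leibniz[OF bracket_section[OF s t] u(1) f]
    by (simp add: algebra_simps)
  thus ?thesis using u(2) by (simp add: br_def)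
qed

end

end

section \<open>Poisson structures lifted to an almost-injective Lie algebroid\<close>

context mfd_lie_algebroid
begin

text \<open>
  The kernel of the transposed anchor from the cotangent space at \<open>p\<close> to the dual of the fibre.
\<close>

definition anchor_annihilator :: "'m \<Rightarrow> ('e \<Rightarrow>\<^sub>L real) set" where
  "anchor_annihilator p = {\<xi>. \<forall>v\<in>vb_fibre A p. blinfun_apply \<xi> (la_anchor A p v) = 0}"

lemma subspace_anchor_annihilator: "subspace (anchor_annihilator p)"
  by (simp add: subspace_def anchor_annihilator_def blinfun.bilinear_simps)

lemma frame_sum_eq_0:
  assumes "(V, e) \<in> vb_frames A" "p \<in> V" "(\<Sum>i<vb_rank A. c i *\<^sub>R e i p) = 0" "i < vb_rank A"
  shows "c i = 0"
proof -
  let ?E = "(\<lambda>i. e i p) ` {..<vb_rank A}"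
  note inj = frame_inj[OF assms(1,2)]
  define u where "u = (\<lambda>w. c (inv_into {..<vb_rank A} (\<lambda>i. e i p) w))"
  have u: "u (e i p) = c i" if "i < vb_rank A" for i
    using inv_into_f_f[OF inj, of i] that by (simp add: u_def)
  have "(\<Sum>w\<in>?E. u w *\<^sub>R w) = 0"
    using assms(3) by (simp add: sum.reindex[OF inj] u)
  hence "u (e i p) = 0"
    using independentD[OF frame_independent[OF assms(1,2)], of ?E u "e i p"] assms(4) by blast
  thus ?thesis using u[OF assms(4)] by simp
qed

lemma anchor_zero: "p \<in> vb_base A \<Longrightarrow> la_anchor A p 0 = 0"
  using anchor_sum[of p "{}"] by simp

lemma anchor_transpose_in_dual:
  assumes "p \<in> vb_base A"
  shows "anchor_transpose A p \<xi> \<in> dual_space (vb_fibre A p)"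
proof -
  note sub = fibre_subspace[OF assms]
  have lin: "la_anchor A p (a *\<^sub>R u + b *\<^sub>R v) = a *\<^sub>R la_anchor A p u + b *\<^sub>R la_anchor A p v"
    if "u \<in> vb_fibre A p" "v \<in> vb_fibre A p" for u v a b
    using anchor assms(1) that by (simp add: smooth_anchor_def)
  have "la_anchor A p (u + v) = la_anchor A p u + la_anchor A p v"
    if "u \<in> vb_fibre A p" "v \<in> vb_fibre A p" for u v
    using lin[OF that, of 1 1] by simp
  moreover have "la_anchor A p (c *\<^sub>R u) = c *\<^sub>R la_anchor A p u" if "u \<in> vb_fibre A p" for u c
    using lin[OF that that, of c 0] by simp
  ultimately show ?thesis
    by (simp add: dual_space_def anchor_transpose_def subspace_add[OF sub] subspace_scale[OF sub]
        blinfun.add_right blinfun.scaleR_right)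
qed

text \<open>
  The set on which the anchor is injective is dense in a nonempty base, hence contains a point.
\<close>

lemma rank_le_dim:
  assumes "almost_injective M A" "vb_base A \<noteq> {}"
  shows "vb_rank A \<le> DIM('e)"
proof -
  obtain W where W: "W \<subseteq> vb_base A" "vb_base A \<subseteq> mtop M closure_of W"
    "\<forall>p\<in>W. inj_on (la_anchor A p) (vb_fibre A p)"
    using assms(1) unfolding almost_injective_def by blast
  have "W \<noteq> {}" using W(2) assms(2) by auto
  then obtain p where p: "p \<in> W" by blast
  hence pb: "p \<in> vb_base A" using W(1) by blast
  obtain V e where Ve: "(V, e) \<in> vb_frames A" "p \<in> V" using frame_exists[OF pb] .
  define r where "r = (\<lambda>i. la_anchor A p (e i p))"
  have inj: "inj_on r {..<vb_rank A}"
    using comp_inj_on[OF frame_inj[OF Ve] inj_on_subset[OF W(3)[rule_format, OF p]]]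
      frame_in_fibre[OF Ve] by (auto simp: r_def o_def)
  have "independent (r ` {..<vb_rank A})"
  proof (rule independent_if_scalars_zero)
    fix u w
    assume u: "(\<Sum>w\<in>r ` {..<vb_rank A}. u w *\<^sub>R w) = 0" and w: "w \<in> r ` {..<vb_rank A}"
    let ?v = "\<Sum>i<vb_rank A. u (r i) *\<^sub>R e i p"
    have "?v \<in> vb_fibre A p"
      by (intro subspace_sum subspace_scale fibre_subspace[OF pb] frame_in_fibre[OF Ve]) auto
    moreover have "0 \<in> vb_fibre A p" by (rule subspace_0[OF fibre_subspace[OF pb]])
    moreover have "la_anchor A p ?v = la_anchor A p 0"
    proof -
      have "la_anchor A p ?v = (\<Sum>i<vb_rank A. u (r i) *\<^sub>R r i)"
        unfolding r_def by (intro anchor_sum pb frame_in_fibre[OF Ve]) auto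
      also have "\<dots> = (\<Sum>w\<in>r ` {..<vb_rank A}. u w *\<^sub>R w)" by (simp add: sum.reindex[OF inj])
      finally show ?thesis by (simp add: u anchor_zero[OF pb])
    qed
    ultimately have "?v = 0" using W(3) p by (auto dest: inj_onD)
    moreover obtain i where i: "i < vb_rank A" "w = r i" using w by auto
    ultimately show "u w = 0" using frame_sum_eq_0[OF Ve, of "\<lambda>i. u (r i)" i] by simp
  qed simp
  hence "card (r ` {..<vb_rank A}) \<le> DIM('e)" using independent_bound by blast
  thus ?thesis by (simp add: card_image[OF inj])
qed

context
  fixes P :: "('m, 'v) vb_bivector" and \<pi> :: "('m, 'e) bivector_field"
  assumes P: "smooth_vb_bivector M A P"
    and lift: "\<And>p. p \<in> vb_base A \<Longrightarrow> anchor_pushforward A P p = \<pi> p"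
begin

text \<open>
  One matrix \<open>c\<close> describes both bivectors, since the pull-back of \<open>\<xi>\<close> under the anchor takes on \<open>e i\<close>
  the value of \<open>\<xi>\<close> on the anchored \<open>e i\<close>.
\<close>

lemma bivector_in_frame:
  assumes "(V, e) \<in> vb_frames A"
  obtains c where "\<forall>i<vb_rank A. \<forall>j<vb_rank A. smooth_fun M V (c i j)"
    "\<forall>p\<in>V. \<forall>\<xi> \<eta>. \<pi> p \<xi> \<eta> = (\<Sum>i<vb_rank A. \<Sum>j<vb_rank A.
      c i j p * blinfun_apply \<xi> (la_anchor A p (e i p)) * blinfun_apply \<eta> (la_anchor A p (e j p)))"
    "\<forall>p\<in>V. \<forall>\<alpha>\<in>dual_space (vb_fibre A p). \<forall>\<beta>\<in>dual_space (vb_fibre A p).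
      P p \<alpha> \<beta> = (\<Sum>i<vb_rank A. \<Sum>j<vb_rank A. c i j p * \<alpha> (e i p) * \<beta> (e j p))"
proof -
  have *: "\<forall>(V, e)\<in>vb_frames A. \<exists>c.
      (\<forall>i<vb_rank A. \<forall>j<vb_rank A. smooth_fun M V (c i j)) \<and>
      (\<forall>p\<in>V. \<forall>\<alpha>\<in>dual_space (vb_fibre A p). \<forall>\<beta>\<in>dual_space (vb_fibre A p).
         P p \<alpha> \<beta> = (\<Sum>i<vb_rank A. \<Sum>j<vb_rank A. c i j p * \<alpha> (e i p) * \<beta> (e j p)))"
    using P by (simp add: smooth_vb_bivector_def)
  obtain c where c1: "\<forall>i<vb_rank A. \<forall>j<vb_rank A. smooth_fun M V (c i j)"
    and c2: "\<forall>p\<in>V. \<forall>\<alpha>\<in>dual_space (vb_fibre A p). \<forall>\<beta>\<in>dual_space (vb_fibre A p).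
       P p \<alpha> \<beta> = (\<Sum>i<vb_rank A. \<Sum>j<vb_rank A. c i j p * \<alpha> (e i p) * \<beta> (e j p))"
    using bspec[OF * assms, unfolded prod.case] by blast
  have "\<pi> p \<xi> \<eta> = (\<Sum>i<vb_rank A. \<Sum>j<vb_rank A.
      c i j p * blinfun_apply \<xi> (la_anchor A p (e i p)) * blinfun_apply \<eta> (la_anchor A p (e j p)))"
    if p: "p \<in> V" for p \<xi> \<eta>
  proof -
    have pb: "p \<in> vb_base A" using frame_subset_base[OF assms] p by blast
    have "\<pi> p \<xi> \<eta> = P p (anchor_transpose A p \<xi>) (anchor_transpose A p \<eta>)"
      by (simp add: lift[OF pb, symmetric] anchor_pushforward_def)
    also have "\<dots> = (\<Sum>i<vb_rank A. \<Sum>j<vb_rank A.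
        c i j p * anchor_transpose A p \<xi> (e i p) * anchor_transpose A p \<eta> (e j p))"
      using c2 p anchor_transpose_in_dual[OF pb] by blast
    also have "\<dots> = (\<Sum>i<vb_rank A. \<Sum>j<vb_rank A.
        c i j p * blinfun_apply \<xi> (la_anchor A p (e i p)) * blinfun_apply \<eta> (la_anchor A p (e j p)))"
      using frame_in_fibre[OF assms p] by (simp add: anchor_transpose_def)
    finally show ?thesis .
  qed
  hence "\<forall>p\<in>V. \<forall>\<xi> \<eta>. \<pi> p \<xi> \<eta> = (\<Sum>i<vb_rank A. \<Sum>j<vb_rank A.
      c i j p * blinfun_apply \<xi> (la_anchor A p (e i p)) * blinfun_apply \<eta> (la_anchor A p (e j p)))" by blast
  with c1 show thesis using c2 by (rule that)
qed

lemma differential_along_frame_smooth: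
  assumes "(V, e) \<in> vb_frames A" "f \<in> smooth_functions M" "i < vb_rank A"
  shows "smooth_fun M V (\<lambda>p. differential M f p (la_anchor A p (e i p)))"
proof -
  have f: "smooth_fun M V f"
    using assms(2) frame_openin[OF assms(1)] openin_subset by (auto intro: smooth_fun_subset)
  show ?thesis by (rule smooth_fun_vector_field[OF anchor_frame_smooth[OF assms(1,3)] f])
qed

text \<open>
  In a frame the bracket is a sum of products with two factors vanishing at \<open>x\<close>, namely the derivatives
  of \<open>f\<close> and of \<open>g\<close> along anchored frame elements.
\<close>

lemma anchor_annihilator_abelian:
  assumes x: "x \<in> vb_base A" and f: "f \<in> smooth_functions M" and g: "g \<in> smooth_functions M"
    and "differential M f x \<in> anchor_annihilator x" "differential M g x \<in> anchor_annihilator x"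
  shows "differential M (poisson_bracket M \<pi> f g) x = 0"
proof -
  obtain V e where Ve: "(V, e) \<in> vb_frames A" and xV: "x \<in> V" using frame_exists[OF x] .
  note oV = frame_openin[OF Ve]
  obtain c where c0: "\<forall>i<vb_rank A. \<forall>j<vb_rank A. smooth_fun M V (c i j)"
    "\<forall>p\<in>V. \<forall>\<xi> \<eta>. \<pi> p \<xi> \<eta> = (\<Sum>i<vb_rank A. \<Sum>j<vb_rank A.
        c i j p * blinfun_apply \<xi> (la_anchor A p (e i p)) * blinfun_apply \<eta> (la_anchor A p (e j p)))"
    "\<forall>p\<in>V. \<forall>\<alpha>\<in>dual_space (vb_fibre A p). \<forall>\<beta>\<in>dual_space (vb_fibre A p).
        P p \<alpha> \<beta> = (\<Sum>i<vb_rank A. \<Sum>j<vb_rank A. c i j p * \<alpha> (e i p) * \<beta> (e j p))"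
    by (rule bivector_in_frame[OF Ve])
  note c = c0[rule_format]
  let ?d = "\<lambda>h i p. blinfun_apply (differential M h p) (la_anchor A p (e i p))"
  have s1: "smooth_fun M V (\<lambda>p. c i j p * ?d f i p)" if "i < vb_rank A" "j < vb_rank A" for i j
    by (intro smooth_fun_mult c(1) differential_along_frame_smooth Ve f that)
  note s2 = differential_along_frame_smooth[OF Ve g]
  have s: "smooth_fun M V (\<lambda>p. c i j p * ?d f i p * ?d g j p)" if "i < vb_rank A" "j < vb_rank A" for i j
    by (intro smooth_fun_mult[OF s1 s2] that)
  have "differential M (poisson_bracket M \<pi> f g) x =
      differential M (\<lambda>p. \<Sum>i<vb_rank A. \<Sum>j<vb_rank A. c i j p * ?d f i p * ?d g j p) x"
    by (rule differential_cong[OF oV xV]) (simp add: poisson_bracket_def c(2))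
  also have "\<dots> = (\<Sum>i<vb_rank A. \<Sum>j<vb_rank A. differential M (\<lambda>p. c i j p * ?d f i p * ?d g j p) x)"
  proof -
    have "smooth_fun M V (\<lambda>p. \<Sum>j<vb_rank A. c i j p * ?d f i p * ?d g j p)" if "i < vb_rank A" for i
      by (intro smooth_fun_sum[OF oV] s that) auto
    thus ?thesis
      by (subst differential_sum[OF oV xV]) (auto intro!: sum.cong differential_sum[OF oV xV] s)
  qed
  also have "\<dots> = 0"
  proof (intro sum.neutral ballI)
    fix i j
    assume "i \<in> {..<vb_rank A}" "j \<in> {..<vb_rank A}"
    hence ij: "i < vb_rank A" "j < vb_rank A" by auto
    have "?d f i x = 0" "?d g j x = 0"
      using assms(4,5) frame_in_fibre[OF Ve xV] ij by (auto simp: anchor_annihilator_def)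
    thus "differential M (\<lambda>p. c i j p * ?d f i p * ?d g j p) x = 0"
      by (simp add: differential_mult[OF s1[OF ij] s2[OF ij(2)] xV])
  qed
  finally show ?thesis .
qed

text \<open>
  Near \<open>x\<close> the bracket is the derivative of \<open>g\<close> along the Hamiltonian section \<open>s\<close> of \<open>f\<close>. It is
  differentiated along a section \<open>a\<close> with \<open>a x = v\<close>, and \<open>a\<close> and \<open>s\<close> are exchanged at the price of
  their bracket. One of the two resulting terms vanishes since \<open>s x\<close> is in the kernel of the anchor, the
  other since \<open>differential M g x\<close> annihilates the image of the anchor.
\<close>

lemma anchor_annihilator_ideal:
  assumes x: "x \<in> vb_base A" and zero: "\<And>\<xi> \<eta>. \<pi> x \<xi> \<eta> = 0"
    and f: "f \<in> smooth_functions M" and g: "g \<in> smooth_functions M"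
    and dg: "differential M g x \<in> anchor_annihilator x"
  shows "differential M (poisson_bracket M \<pi> f g) x \<in> anchor_annihilator x"
  unfolding anchor_annihilator_def
proof (intro CollectI ballI)
  fix v
  assume v: "v \<in> vb_fibre A x"
  show "differential M (poisson_bracket M \<pi> f g) x (la_anchor A x v) = 0"
  proof (cases "v = 0")
    case True
    thus ?thesis by (simp add: anchor_zero[OF x] blinfun.zero_right)
  next
    case False
    obtain V e where Ve: "(V, e) \<in> vb_frames A" and xV: "x \<in> V" using frame_exists[OF x] .
    note oV = frame_openin[OF Ve]
    note Vb = frame_subset_base[OF Ve]
    obtain c where c0: "\<forall>i<vb_rank A. \<forall>j<vb_rank A. smooth_fun M V (c i j)"
      "\<forall>p\<in>V. \<forall>\<xi> \<eta>. \<pi> p \<xi> \<eta> = (\<Sum>i<vb_rank A. \<Sum>j<vb_rank A.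
          c i j p * blinfun_apply \<xi> (la_anchor A p (e i p)) * blinfun_apply \<eta> (la_anchor A p (e j p)))"
      "\<forall>p\<in>V. \<forall>\<alpha>\<in>dual_space (vb_fibre A p). \<forall>\<beta>\<in>dual_space (vb_fibre A p).
          P p \<alpha> \<beta> = (\<Sum>i<vb_rank A. \<Sum>j<vb_rank A. c i j p * \<alpha> (e i p) * \<beta> (e j p))"
      by (rule bivector_in_frame[OF Ve])
    note c = c0[rule_format]
    obtain \<kappa> :: "'m \<Rightarrow> real" and K where \<kappa>: "smooth_fun M (topspace (mtop M)) \<kappa>" "\<kappa> x = 1"
      "closedin (mtop M) K" "K \<subseteq> V" "\<forall>q. q \<notin> K \<longrightarrow> \<kappa> q = 0"
      by (rule smooth_bump[OF oV xV])
    define cut where "cut = (\<lambda>h p. if p \<in> V then \<kappa> p *\<^sub>R (\<Sum>i<vb_rank A. h i p *\<^sub>R e i p) else 0)"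
    have cut: "cut h \<in> vb_sections M A" if "\<And>i. i < vb_rank A \<Longrightarrow> smooth_fun M V (h i)" for h
      unfolding cut_def by (rule section_cutoff[OF Ve \<kappa>(1,3-5) that])
    have anchor_cut: "la_anchor A p (cut h p) = \<kappa> p *\<^sub>R (\<Sum>i<vb_rank A. h i p *\<^sub>R la_anchor A p (e i p))"
      if "p \<in> V" for h p
    proof -
      have "la_anchor A p (cut h p) = la_anchor A p (\<Sum>i<vb_rank A. (\<kappa> p * h i p) *\<^sub>R e i p)"
        using that by (simp add: cut_def scaleR_sum_right)
      also have "\<dots> = (\<Sum>i<vb_rank A. (\<kappa> p * h i p) *\<^sub>R la_anchor A p (e i p))"
        using that Vb frame_in_fibre[OF Ve] by (intro anchor_sum) auto
      finally show ?thesis by (simp add: scaleR_sum_right)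
    qed
    \<comment> \<open>The Hamiltonian section of \<open>f\<close> near \<open>x\<close>, multiplied by the cut-off \<open>\<kappa>\<close>.\<close>
    define h where "h = (\<lambda>j p. \<Sum>i<vb_rank A. c i j p * differential M f p (la_anchor A p (e i p)))"
    define s where "s = cut h"
    have h: "smooth_fun M V (h j)" if "j < vb_rank A" for j
      unfolding h_def
      by (intro smooth_fun_sum oV smooth_fun_mult c(1) differential_along_frame_smooth Ve f) (use that in auto)
    hence s: "s \<in> vb_sections M A" unfolding s_def by (rule cut)
    have s_pi: "\<eta> (la_anchor A p (s p)) = \<kappa> p * \<pi> p (differential M f p) \<eta>" if "p \<in> V" for p and \<eta> :: "'e \<Rightarrow>\<^sub>L real"
      unfolding s_def anchor_cut[OF that] c(2)[OF that] h_def
      by (subst sum.swap) (simp add: blinfun.scaleR_right blinfun.sum_right sum_distrib_right)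
    \<comment> \<open>\<open>s_pi\<close> at \<open>x\<close> shows that every covector vanishes on the anchored \<open>s x\<close>; the inner product
      with this vector itself is enough.\<close>
    have sx: "la_anchor A x (s x) = 0"
    proof -
      let ?w = "la_anchor A x (s x)"
      have "blinfun_apply (Blinfun (\<lambda>u. u \<bullet> ?w)) ?w = 0" using s_pi[OF xV] by (simp add: zero)
      thus ?thesis by (simp add: bounded_linear_Blinfun_apply bounded_linear_inner_left)
    qed
    obtain \<alpha> where \<alpha>: "v = (\<Sum>i<vb_rank A. \<alpha> i *\<^sub>R e i x)" using frame_coordinates[OF Ve xV v] .
    define a where "a = cut (\<lambda>i p. \<alpha> i)"
    have a: "a \<in> vb_sections M A" unfolding a_def by (intro cut smooth_fun_const oV)
    have ax: "a x = v" using xV \<kappa>(2) by (simp add: a_def cut_def \<alpha>)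
    have gb: "smooth_fun M (vb_base A) g"
      using g base_openin openin_subset by (auto intro: smooth_fun_subset)
    \<comment> \<open>The auxiliary section that must not vanish at \<open>x\<close> is \<open>a\<close> itself, whence the case
      distinction on \<open>v\<close>.\<close>
    have "anchored_derivative (la_bracket A a s) g x =
        anchored_derivative a (anchored_derivative s g) x - anchored_derivative s (anchored_derivative a g) x"
      using a s gb a False unfolding ax[symmetric] by (rule anchor_bracket)
    moreover have "la_bracket A a s x \<in> vb_fibre A x"
      by (intro section_in_fibre bracket_section a s x)
    hence "anchored_derivative (la_bracket A a s) g x = 0"
      using dg by (simp add: anchor_annihilator_def)
    moreover have "anchored_derivative s (anchored_derivative a g) x = 0"
      by (simp add: sx blinfun.zero_right)
    ultimately have "differential M (anchored_derivative s g) x (la_anchor A x v) = 0"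
      by (simp add: ax)
    moreover have "differential M (anchored_derivative s g) x = differential M (poisson_bracket M \<pi> f g) x"
    proof -
      have "smooth_fun M V (\<lambda>p. \<Sum>j<vb_rank A. h j p * differential M g p (la_anchor A p (e j p)))"
        by (intro smooth_fun_sum oV smooth_fun_mult h differential_along_frame_smooth Ve g) auto
      moreover have "(\<Sum>j<vb_rank A. h j p * differential M g p (la_anchor A p (e j p))) =
          poisson_bracket M \<pi> f g p" if "p \<in> V" for p
        unfolding poisson_bracket_def c(2)[OF that] h_def by (subst sum.swap) (simp add: sum_distrib_right)
      ultimately have fg: "smooth_fun M V (poisson_bracket M \<pi> f g)" by (rule smooth_fun_cong)
      have "differential M (anchored_derivative s g) x =
          differential M (\<lambda>p. \<kappa> p * poisson_bracket M \<pi> f g p) x"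
        by (rule differential_cong[OF oV xV]) (simp add: s_pi poisson_bracket_def)
      \<comment> \<open>The cut-off function is \<open>1\<close> at \<open>x\<close> only, but its derivative is multiplied by the bracket,
        which is zero at \<open>x\<close>.\<close>
      also have "\<dots> = differential M (poisson_bracket M \<pi> f g) x"
        using differential_mult[OF smooth_fun_subset[OF \<kappa>(1) oV openin_subset[OF oV]] fg xV]
        by (simp add: \<kappa>(2)) (simp add: poisson_bracket_def zero)
      finally show ?thesis .
    qed
    ultimately show ?thesis by simp
  qed
qed

text \<open>
  A trivial annihilator makes the anchor at \<open>x\<close> onto, and by \<open>rank_le_dim\<close> an isomorphism. Then every
  functional on the fibre is pulled back from the cotangent space, so \<open>P x\<close> inherits the vanishing of
  \<open>\<pi> x\<close>, and \<open>sharp\<close> cannot be onto a fibre of positive dimension.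
\<close>

lemma anchor_annihilator_nonzero:
  assumes x: "x \<in> vb_base A" and zero: "\<And>\<xi> \<eta>. \<pi> x \<xi> \<eta> = 0"
    and nondegenerate: "vb_nondegenerate A P" and injective: "almost_injective M A"
  shows "anchor_annihilator x \<noteq> {0}"
proof
  assume trivial: "anchor_annihilator x = {0}"
  obtain V e where Ve: "(V, e) \<in> vb_frames A" and xV: "x \<in> V" using frame_exists[OF x] .
  obtain c where c0: "\<forall>i<vb_rank A. \<forall>j<vb_rank A. smooth_fun M V (c i j)"
    "\<forall>p\<in>V. \<forall>\<xi> \<eta>. \<pi> p \<xi> \<eta> = (\<Sum>i<vb_rank A. \<Sum>j<vb_rank A.
        c i j p * blinfun_apply \<xi> (la_anchor A p (e i p)) * blinfun_apply \<eta> (la_anchor A p (e j p)))"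
    "\<forall>p\<in>V. \<forall>\<alpha>\<in>dual_space (vb_fibre A p). \<forall>\<beta>\<in>dual_space (vb_fibre A p).
        P p \<alpha> \<beta> = (\<Sum>i<vb_rank A. \<Sum>j<vb_rank A. c i j p * \<alpha> (e i p) * \<beta> (e j p))"
    by (rule bivector_in_frame[OF Ve])
  note c = c0[rule_format]
  define r where "r = (\<lambda>i. la_anchor A x (e i x))"
  let ?R = "r ` {..<vb_rank A}"
  have span: "span ?R = UNIV"
  proof (rule ccontr)
    assume "span ?R \<noteq> UNIV"
    then obtain a where a: "a \<noteq> 0" "\<forall>w\<in>span ?R. a \<bullet> w = 0" using span_not_UNIV_orthogonal by blast
    have ap: "blinfun_apply (Blinfun (\<lambda>w. a \<bullet> w)) = (\<lambda>w. a \<bullet> w)"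
      by (rule bounded_linear_Blinfun_apply[OF bounded_linear_inner_right])
    have "Blinfun (\<lambda>w. a \<bullet> w) \<in> anchor_annihilator x"
      unfolding anchor_annihilator_def
    proof (intro CollectI ballI)
      fix v assume v: "v \<in> vb_fibre A x"
      obtain \<alpha> where \<alpha>: "v = (\<Sum>i<vb_rank A. \<alpha> i *\<^sub>R e i x)" using frame_coordinates[OF Ve xV v] .
      have "la_anchor A x v = (\<Sum>i<vb_rank A. \<alpha> i *\<^sub>R r i)"
        unfolding \<alpha> r_def by (intro anchor_sum x frame_in_fibre[OF Ve xV]) auto
      also have "\<dots> \<in> span ?R" by (intro span_sum span_scale span_base) auto
      finally have "la_anchor A x v \<in> span ?R" .
      thus "blinfun_apply (Blinfun (\<lambda>w. a \<bullet> w)) (la_anchor A x v) = 0" using a(2) ap by simp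
    qed
    hence "Blinfun (\<lambda>w. a \<bullet> w) = 0" using trivial by simp
    hence "a \<bullet> a = 0" using ap by (metis zero_blinfun.rep_eq)
    thus False using a(1) by simp
  qed
  have "vb_rank A \<le> DIM('e)" using rank_le_dim[OF injective] x by blast
  moreover have "card ?R \<le> vb_rank A" using card_image_le[of "{..<vb_rank A}" r] by simp
  moreover have "DIM('e) \<le> card ?R" using dim_le_card[of UNIV ?R] span by simp
  ultimately have card: "card ?R = vb_rank A" "card ?R = DIM('e)" by auto
  have inj: "inj_on r {..<vb_rank A}" using card(1) by (intro eq_card_imp_inj_on) auto
  have indep: "independent ?R"
    using card(2) span by (intro card_le_dim_spanning[of _ UNIV]) auto
  \<comment> \<open>Injectivity and independence make prescribed values on the anchored frame consistent.\<close>
  have extend: "\<exists>\<xi>. \<forall>i<vb_rank A. blinfun_apply \<xi> (r i) = \<alpha> (e i x)" for \<alpha> :: "'v \<Rightarrow> real"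
  proof -
    obtain g where g: "linear g" "\<forall>w\<in>?R. g w = \<alpha> (e (inv_into {..<vb_rank A} r w) x)"
      using linear_independent_extend[OF indep, of "\<lambda>w. \<alpha> (e (inv_into {..<vb_rank A} r w) x)"] by blast
    have "blinfun_apply (Blinfun g) = g"
      using g(1) by (simp add: bounded_linear_Blinfun_apply linear_conv_bounded_linear)
    thus ?thesis using g(2) by (intro exI[of _ "Blinfun g"]) (simp add: inv_into_f_f[OF inj])
  qed
  have Px: "P x \<alpha> \<beta> = 0" if "\<alpha> \<in> dual_space (vb_fibre A x)" "\<beta> \<in> dual_space (vb_fibre A x)" for \<alpha> \<beta>
  proof -
    obtain \<xi> where \<xi>: "\<forall>i<vb_rank A. blinfun_apply \<xi> (r i) = \<alpha> (e i x)" using extend ..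
    obtain \<eta> where \<eta>: "\<forall>i<vb_rank A. blinfun_apply \<eta> (r i) = \<beta> (e i x)" using extend ..
    have "P x \<alpha> \<beta> = \<pi> x \<xi> \<eta>"
      unfolding c(3)[OF xV that] c(2)[OF xV] using \<xi> \<eta> by (simp add: r_def)
    thus ?thesis by (simp add: zero)
  qed
  \<comment> \<open>The condition that defines \<open>sharp\<close> no longer depends on \<open>\<alpha>\<close>, so \<open>sharp\<close> is constant.\<close>
  define v0 where "v0 = (THE v. v \<in> vb_fibre A x \<and> (\<forall>\<beta>\<in>dual_space (vb_fibre A x). \<beta> v = 0))"
  have "sharp (vb_fibre A x) (P x) \<alpha> = v0" if "\<alpha> \<in> dual_space (vb_fibre A x)" for \<alpha>
    unfolding sharp_def v0_def using Px[OF that] by (intro arg_cong[where f=The] ext) auto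
  moreover have "sharp (vb_fibre A x) (P x) ` dual_space (vb_fibre A x) = vb_fibre A x"
    using nondegenerate x by (auto simp: vb_nondegenerate_def bij_betw_def)
  ultimately have single: "vb_fibre A x \<subseteq> {v0}" by blast
  have pos: "0 < vb_rank A" using card DIM_positive[where 'a='e] by linarith
  have "e 0 x \<in> vb_fibre A x" "0 \<in> vb_fibre A x"
    using frame_in_fibre[OF Ve xV pos] subspace_0[OF fibre_subspace[OF x]] by auto
  hence "e 0 x = 0" using single by blast
  moreover have "e 0 x \<in> (\<lambda>i. e i x) ` {..<vb_rank A}" using pos by blast
  ultimately show False using frame_independent[OF Ve xV] dependent_zero by metis
qed

end

end

section \<open>The abelian ideal\<close>

theorem corollary26:
  fixes M :: "('m, 'e::euclidean_space) mfd" and \<pi> :: "('m, 'e) bivector_field" and x :: 'm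
  assumes "poisson_manifold M \<pi>"
    and "isotropy_point M \<pi> x"
    and "locally_desingularizable TYPE('v::real_vector) M \<pi> x"
  shows "\<exists>I. lie_ideal (isotropy_bracket M \<pi> x) I \<and> lie_abelian_on (isotropy_bracket M \<pi> x) I \<and> I \<noteq> {0}"
proof -
  obtain A :: "('m, 'v, 'e) lie_algebroid" and P where x: "x \<in> vb_base A"
    and S: "symplectic_lie_algebroid M A P" and injective: "almost_injective M A"
    and lift: "\<forall>p\<in>vb_base A. anchor_pushforward A P p = \<pi> p"
    using assms(3) unfolding locally_desingularizable_def by blast
  have M: "smooth_manifold M" and \<pi>: "smooth_bivector_field M \<pi>"
    using assms(1) by (auto simp: poisson_manifold_def)
  have A: "is_lie_algebroid M A" and P: "smooth_vb_bivector M A P" and nd: "vb_nondegenerate A P"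
    using S by (auto simp: symplectic_lie_algebroid_def)
  interpret mfd_lie_algebroid M A by unfold_locales (fact M A)+
  have top: "x \<in> topspace (mtop M)" and zero: "\<And>\<xi> \<eta>. \<pi> x \<xi> \<eta> = 0"
    using assms(2) by (auto simp: isotropy_point_def)
  have bracket: "\<exists>f\<in>smooth_functions M. \<exists>g\<in>smooth_functions M. differential M f x = \<xi> \<and>
      differential M g x = \<eta> \<and> isotropy_bracket M \<pi> x \<xi> \<eta> = differential M (poisson_bracket M \<pi> f g) x"
    for \<xi> \<eta>
  proof -
    obtain f where f: "f \<in> smooth_functions M" "differential M f x = \<xi>"
      using exists_smooth_function_with_differential[OF top] by blast
    obtain g where g: "g \<in> smooth_functions M" "differential M g x = \<eta>"
      using exists_smooth_function_with_differential[OF top] by blast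
    show ?thesis using f g isotropy_bracket_eq[OF \<pi> assms(2) f(1) g(1)] by blast
  qed
  have lift': "\<And>p. p \<in> vb_base A \<Longrightarrow> anchor_pushforward A P p = \<pi> p" using lift by blast
  have "lie_ideal (isotropy_bracket M \<pi> x) (anchor_annihilator x)"
    unfolding lie_ideal_def
  proof (intro conjI allI ballI subspace_anchor_annihilator)
    fix \<xi> \<eta>
    assume \<eta>: "\<eta> \<in> anchor_annihilator x"
    obtain f g where fg: "f \<in> smooth_functions M" "g \<in> smooth_functions M" "differential M g x = \<eta>"
      "isotropy_bracket M \<pi> x \<xi> \<eta> = differential M (poisson_bracket M \<pi> f g) x"
      using bracket by blast
    show "isotropy_bracket M \<pi> x \<xi> \<eta> \<in> anchor_annihilator x"
      unfolding fg(4) by (rule anchor_annihilator_ideal[OF P lift' x zero fg(1,2)]) (simp_all add: fg(3) \<eta>)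
  qed
  moreover have "lie_abelian_on (isotropy_bracket M \<pi> x) (anchor_annihilator x)"
    unfolding lie_abelian_on_def
  proof (intro ballI)
    fix \<xi> \<eta>
    assume \<xi>: "\<xi> \<in> anchor_annihilator x" and \<eta>: "\<eta> \<in> anchor_annihilator x"
    obtain f g where fg: "f \<in> smooth_functions M" "g \<in> smooth_functions M"
      "differential M f x = \<xi>" "differential M g x = \<eta>"
      "isotropy_bracket M \<pi> x \<xi> \<eta> = differential M (poisson_bracket M \<pi> f g) x"
      using bracket by blast
    show "isotropy_bracket M \<pi> x \<xi> \<eta> = 0"
      unfolding fg(5) by (rule anchor_annihilator_abelian[OF P lift' x fg(1,2)]) (simp_all add: fg(3,4) \<xi> \<eta>)
  qed
  moreover have "anchor_annihilator x \<noteq> {0}"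
    by (rule anchor_annihilator_nonzero[OF P lift' x zero nd injective])
  ultimately show ?thesis by blast
qed

end
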